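(* Let $K$ be a field, let $G$ be a finite simple graph on $n$ vertices $x_1,\ldots,x_n$ which is not the complete graph $K_n$, and let $k=\kappa(G)$ be its vertex connectivity. Let $S=K[x_1,\ldots,x_n]$, let $I(G^c)\subset S$ be the edge ideal of the complementary graph $G^c$ of $G$, and let $I(G^c)^{(2)}$ be its second symbolic power. Then $$\operatorname{depth}\, S/I(G^c)^{(2)}\;\geq\;\left\lceil\frac{k}{2(n-k-1)}\right\rceil.$$
   Context: All graphs are finite and simple. For a graph $G$ with vertex set $V(G)$ and $W\subset V(G)$, $G-W$ denotes the induced subgraph of $G$ on $V(G)\setminus W$. If $G$ is not a complete graph, the vertex connectivity $\kappa(G)$ is the smallest cardinality of a subset $W\subset V(G)$ for which $G-W$ is disconnected (so $\kappa(G)=0$ if and only if $G$ is disconnected). The complementary graph $G^c$ has the same vertex set as $G$, and two distinct vertices are adjacent in $G^c$ if and only if they are not adjacent in $G$. For a graph $H$ on the vertex set $\{x_1,\ldots,x_n\}$, the edge ideal of $H$ is $I(H)=(x_ix_j : 1\leq i<j\leq n,\ \{x_i,x_j\}\in E(H))\subset S=K[x_1,\ldots,x_n]$, where vertices are identified with variables. For a squarefree monomial ideal $I$ with minimal primes $P_1,\ldots,P_m$, the second symbolic power is $I^{(2)}=P_1^2\cap\cdots\cap P_m^2$. Depth is taken with respect to the graded maximal ideal $(x_1,\ldots,x_n)$ of $S$. *)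

theory Defs
  imports
    "Graph_Theory.Graph_Theory"
    "HOL-Library.Extended_Nat"
    "HOL-Library.Poly_Mapping"
    "HOL-Algebra.Module"
    "HOL-Algebra.QuotRing"
    "HOL-Algebra.Ideal_Product"
begin

section \<open>Graphs\<close>

text \<open>
  A finite simple graph is a \<^locale>\<open>pair_graph\<close>: a finite, loop-free digraph without parallel arcs
  whose arc set is symmetric.  An edge is represented by the two arcs \<open>(u, v)\<close> and \<open>(v, u)\<close>.
\<close>

definition complement_graph :: "'v pair_pre_digraph \<Rightarrow> 'v pair_pre_digraph" where
  "complement_graph G =
     \<lparr>pverts = pverts G,
      parcs = {(u, v). u \<in> pverts G \<and> v \<in> pverts G \<and> u \<noteq> v \<and> (u, v) \<notin> parcs G}\<rparr>"

text \<open>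
  The notion is only meant for non-complete graphs.  The library regards the graph without vertices
  as not connected, so \<open>W = pverts G\<close> is always admitted below.  This does not change the minimum
  if \<open>G\<close> is not complete: deleting all vertices but two non-adjacent ones also disconnects \<open>G\<close>.
\<close>

definition vertex_connectivity :: "'v pair_pre_digraph \<Rightarrow> nat" where
  "vertex_connectivity G =
     (LEAST c. \<exists>W \<subseteq> pverts G.
        card W = c \<and> \<not> Digraph_Component.connected (with_proj G \<restriction> (pverts G - W)))"

lemma pair_graph_complement:
  assumes "pair_graph G"
  shows "pair_graph (complement_graph G)"
proof -
  interpret pair_graph G by fact
  have "parcs (complement_graph G) \<subseteq> pverts G \<times> pverts G" by (auto simp: complement_graph_def)
  moreover have "finite (pverts G \<times> pverts G)" by simp
  ultimately have fin: "finite (parcs (complement_graph G))" by (rule finite_subset)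
  show ?thesis
    by unfold_locales (use fin arcs_symmetric in \<open>auto simp: complement_graph_def symmetric_def intro!: symI\<close>)
qed

lemma vertex_connectivity_bound:
  assumes "pair_graph G" "\<not> complete_digraph (card (pverts G)) (with_proj G)"
  shows "vertex_connectivity G + 2 \<le> card (pverts G)"
proof -
  interpret pair_graph G by fact
  obtain u v where uv: "u \<in> pverts G" "v \<in> pverts G" "u \<noteq> v" "(u,v) \<notin> parcs G"
  proof -
    have "parcs G \<noteq> {(u, v). (u, v) \<in> pverts G \<times> pverts G \<and> u \<noteq> v}"
      using assms(2) unfolding complete_digraph_pair_def by auto
    moreover have "parcs G \<subseteq> {(u, v). (u, v) \<in> pverts G \<times> pverts G \<and> u \<noteq> v}"
      using in_arcsD1 in_arcsD2 no_loops' by blast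
    ultimately show ?thesis using that by blast
  qed
  let ?W = "pverts G - {u,v}" let ?H = "with_proj G \<restriction> {u,v}"
  have H: "arcs_ends (mk_symmetric ?H) = {}"
    using uv arcs_symmetric no_loops' by (auto simp: mk_symmetric_def arcs_ends_def arc_to_ends_def)
  have "\<not> reachable (with_proj (mk_symmetric ?H)) u v"
    unfolding reachable_def using H uv by (auto elim: rtrancl_on.cases)
  then have "\<not> Digraph_Component.connected ?H"
    unfolding connected_def strongly_connected_def by (auto simp: mk_symmetric_def)
  moreover have "pverts G - ?W = {u,v}" using uv by auto
  ultimately have "vertex_connectivity G \<le> card ?W"
    unfolding vertex_connectivity_def by (intro Least_le exI[of _ ?W]) auto
  moreover have "card ?W = card (pverts G) - 2" using uv by (simp add: card_Diff_subset)
  moreover have "card {u,v} \<le> card (pverts G)" using uv by (intro card_mono) auto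
  ultimately show ?thesis using uv by simp
qed


section \<open>Polynomial rings and edge ideals\<close>

text \<open>
  A monomial is a finitely supported exponent function of type \<open>'v \<Rightarrow>\<^sub>0 nat\<close>, a polynomial a finitely
  supported function from monomials to coefficients; the product of \<^theory>\<open>HOL-Library.Poly_Mapping\<close>
  is convolution.  \<open>mpoly_ring V\<close> consists of the polynomials that only involve variables in \<open>V\<close>.
\<close>

definition mpoly_ring :: "'v set \<Rightarrow> (('v \<Rightarrow>\<^sub>0 nat) \<Rightarrow>\<^sub>0 'k::comm_ring_1) ring" where
  "mpoly_ring V =
     \<lparr>carrier = {p. \<forall>m \<in> Poly_Mapping.keys p. Poly_Mapping.keys m \<subseteq> V},
      mult = (*), one = 1, zero = 0, add = (+)\<rparr>"

definition mvar :: "'v \<Rightarrow> ('v \<Rightarrow>\<^sub>0 nat) \<Rightarrow>\<^sub>0 'k::comm_ring_1" where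
  "mvar v = Poly_Mapping.single (Poly_Mapping.single v 1) 1"

definition graded_maximal_ideal :: "'v set \<Rightarrow> (('v \<Rightarrow>\<^sub>0 nat) \<Rightarrow>\<^sub>0 'k::comm_ring_1) set" where
  "graded_maximal_ideal V = Idl\<^bsub>mpoly_ring V\<^esub> (mvar ` V)"

definition edge_ideal :: "'v pair_pre_digraph \<Rightarrow> (('v \<Rightarrow>\<^sub>0 nat) \<Rightarrow>\<^sub>0 'k::comm_ring_1) set" where
  "edge_ideal H = Idl\<^bsub>mpoly_ring (pverts H)\<^esub> {mvar u * mvar v | u v. (u, v) \<in> parcs H}"

lemma cring_mpoly_ring:
  "cring (mpoly_ring V :: (('v \<Rightarrow>\<^sub>0 nat) \<Rightarrow>\<^sub>0 'k::comm_ring_1) ring)"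
    (is "cring ?R")
proof -
  have add: "p + q \<in> carrier ?R" if "p \<in> carrier ?R" "q \<in> carrier ?R" for p q :: "('v \<Rightarrow>\<^sub>0 nat) \<Rightarrow>\<^sub>0 'k"
    using that Poly_Mapping.keys_add[of p q] unfolding mpoly_ring_def by fastforce
  have mult: "p * q \<in> carrier ?R" if p: "p \<in> carrier ?R" and q: "q \<in> carrier ?R" for p q :: "('v \<Rightarrow>\<^sub>0 nat) \<Rightarrow>\<^sub>0 'k"
  proof -
    have "x \<in> V" if m: "m \<in> Poly_Mapping.keys (p * q)" and x: "x \<in> Poly_Mapping.keys m" for m x
    proof -
      obtain a b where "m = a + b" "a \<in> Poly_Mapping.keys p" "b \<in> Poly_Mapping.keys q"
        using m Poly_Mapping.keys_mult[of p q] by blast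
      then show "x \<in> V"
        using x p q Poly_Mapping.keys_add[of a b] unfolding mpoly_ring_def by fastforce
    qed
    then show ?thesis unfolding mpoly_ring_def by auto
  qed
  have neg: "- p \<in> carrier ?R" if "p \<in> carrier ?R" for p :: "('v \<Rightarrow>\<^sub>0 nat) \<Rightarrow>\<^sub>0 'k"
    using that unfolding mpoly_ring_def by simp
  have zo: "0 \<in> carrier ?R" "1 \<in> carrier ?R"
    unfolding mpoly_ring_def by simp_all
  have ops: "x \<oplus>\<^bsub>?R\<^esub> y = x + y" "x \<otimes>\<^bsub>?R\<^esub> y = x * y" "\<zero>\<^bsub>?R\<^esub> = 0" "\<one>\<^bsub>?R\<^esub> = 1" for x y
    unfolding mpoly_ring_def by simp_all
  have "abelian_group ?R"
  proof (rule abelian_groupI)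
    fix p assume "p \<in> carrier ?R"
    then show "\<exists>q \<in> carrier ?R. q \<oplus>\<^bsub>?R\<^esub> p = \<zero>\<^bsub>?R\<^esub>"
      unfolding ops by (intro bexI[of _ "- p"] neg) simp_all
  qed (unfold ops, auto intro: add zo simp: add.assoc add.commute)
  moreover have "comm_monoid ?R"
    by (rule comm_monoidI) (unfold ops, auto intro: mult zo simp: mult.assoc mult.commute)
  ultimately show ?thesis
    by (rule cringI) (unfold ops, simp add: distrib_right)
qed


section \<open>Second symbolic power\<close>

definition minimal_primes :: "('a, 'c) ring_scheme \<Rightarrow> 'a set \<Rightarrow> 'a set set" where
  "minimal_primes R I =
     {P. primeideal P R \<and> I \<subseteq> P \<and> (\<forall>Q. primeideal Q R \<and> I \<subseteq> Q \<and> Q \<subseteq> P \<longrightarrow> Q = P)}"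

definition second_symbolic_power :: "('a, 'c) ring_scheme \<Rightarrow> 'a set \<Rightarrow> 'a set" where
  "second_symbolic_power R I = (\<Inter>P \<in> minimal_primes R I. P \<cdot>\<^bsub>R\<^esub> P)"


section \<open>Depth of a module\<close>

text \<open>The residue class ring of \<open>R\<close> modulo \<open>J\<close>, regarded as an \<open>R\<close>-module.\<close>

definition quot_module :: "('a, 'c) ring_scheme \<Rightarrow> 'a set \<Rightarrow> ('a, 'a set) module" where
  "quot_module R J =
     \<lparr>carrier = carrier (R Quot J), mult = mult (R Quot J), one = one (R Quot J),
      zero = zero (R Quot J), add = add (R Quot J),
      smult = (\<lambda>a X. (J +>\<^bsub>R\<^esub> a) \<otimes>\<^bsub>R Quot J\<^esub> X)\<rparr>"

lemma module_quot_module: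
  fixes R (structure)
  assumes "cring R" "ideal J R"
  shows "module R (quot_module R J)"
proof -
  interpret R: cring R by fact
  interpret ideal J R by fact
  interpret Q: cring "R Quot J" using quotient_is_cring[OF assms(1)] .
  have hom: "ring_hom_ring R (R Quot J) ((+>) J)" by (rule rcos_ring_hom_ring)
  interpret h: ring_hom_ring R "R Quot J" "(+>) J" by (rule hom)
  let ?M = "quot_module R J"
  have ops: "x \<oplus>\<^bsub>?M\<^esub> y = x \<oplus>\<^bsub>R Quot J\<^esub> y" "\<zero>\<^bsub>?M\<^esub> = \<zero>\<^bsub>R Quot J\<^esub>" "carrier ?M = carrier (R Quot J)"
    "a \<odot>\<^bsub>?M\<^esub> x = (J +> a) \<otimes>\<^bsub>R Quot J\<^esub> x" for x y a
    unfolding quot_module_def by simp_all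
  have "abelian_group ?M"
  proof (rule abelian_groupI)
    fix x assume "x \<in> carrier ?M"
    then show "\<exists>y\<in>carrier ?M. y \<oplus>\<^bsub>?M\<^esub> x = \<zero>\<^bsub>?M\<^esub>"
      unfolding ops using Q.l_neg Q.a_inv_closed by blast
  qed (unfold ops, simp_all add: Q.a_ac)
  then show ?thesis
    apply (intro moduleI)
    unfolding ops apply (auto intro: assms)
    apply (metis h.hom_add h.hom_mult h.hom_one h.hom_closed Q.m_closed Q.l_one Q.l_distr Q.r_distr Q.m_assoc)+
    done
qed

text \<open>The submodule \<open>(f\<^sub>1, \<dots>, f\<^sub>r) M\<close>.\<close>

definition seq_submodule :: "('a, 'b, 'c) module_scheme \<Rightarrow> 'a list \<Rightarrow> 'b set" where
  "seq_submodule M fs =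
     {\<Oplus>\<^bsub>M\<^esub>i\<in>{..<length fs}. (fs ! i) \<odot>\<^bsub>M\<^esub> x i | x. x \<in> {..<length fs} \<rightarrow> carrier M}"

text \<open>
  The first condition says that \<open>f\<^sub>i\<close> is a non-zero-divisor on \<open>M / (f\<^sub>1, \<dots>, f\<^sub>i\<^sub>-\<^sub>1) M\<close>,
  written out for representatives in \<open>M\<close>.
\<close>

definition regular_sequence :: "('a, 'b, 'c) module_scheme \<Rightarrow> 'a list \<Rightarrow> bool" where
  "regular_sequence M fs \<longleftrightarrow>
     (\<forall>i < length fs. \<forall>x \<in> carrier M.
        (fs ! i) \<odot>\<^bsub>M\<^esub> x \<in> seq_submodule M (take i fs) \<longrightarrow> x \<in> seq_submodule M (take i fs)) \<and>
     seq_submodule M fs \<noteq> carrier M"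

definition depth :: "'a set \<Rightarrow> ('a, 'b, 'c) module_scheme \<Rightarrow> enat" where
  "depth \<mm> M = Sup {enat (length fs) | fs. set fs \<subseteq> \<mm> \<and> regular_sequence M fs}"

end

theory Submission
  imports Defs
begin

text \<open>
  Let \<open>H\<close> be the complementary graph and \<open>d = n - k - 1\<close>.  A vertex of \<open>H\<close> of degree larger than \<open>d\<close>
  would have fewer than \<open>k\<close> neighbours in \<open>G\<close>, and deleting these would disconnect \<open>G\<close>; so \<open>H\<close> has
  maximal degree at most \<open>d\<close>, and this is all that is used of \<open>k\<close>.  If \<open>2 d t < n + 2 d\<close>, the first \<open>t\<close>
  elementary symmetric polynomials of all variables turn out to be a regular sequence on
  \<open>S / I(H)\<^sup>(\<^sup>2\<^sup>)\<close>.

  They are one on the polynomial ring \<open>K[F]\<close> for every set \<open>F\<close> of at least \<open>t\<close> variables, and weak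
  regularity passes from \<open>S/(J : m)\<close> and \<open>S/(J + m)\<close> to \<open>S/J\<close>.  It therefore suffices to reach
  quotients \<open>K[F]\<close> with \<open>|F| \<ge> t\<close> by repeatedly replacing \<open>J\<close> by \<open>J : m\<close> and \<open>J + m\<close> with monomials \<open>m\<close>.
  Starting from \<open>I(H)\<^sup>(\<^sup>2\<^sup>)\<close>, the edge monomials \<open>x\<^sub>v x\<^sub>w\<close> are adjoined one at a time until \<open>I(H)\<close> is reached;
  the colon ideals met on the way are squarefree.  Squarefree ideals are split at variables, where
  each new free variable costs at most \<open>2 d\<close> vertices of \<open>H\<close>.
\<close>

section \<open>Weakly regular sequences modulo an ideal\<close>


text \<open>Depth along short exact sequences is usually controlled homologically. Here all
  quotients are tested with one and the same sequence, so that regularity can be passed along by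
  computing with representatives. The elementary symmetric polynomials of all variables make such a
  uniform choice possible: setting the variables outside \<open>F\<close> to zero turns them into
  those of \<open>F\<close>.

  The bookkeeping rests on one count. With \<open>A\<close> the vertices still bound by edges of
  \<open>H\<close> and \<open>F\<close> the free variables,
  \<open>card A + 2 * d * (card F + 1)\<close> has to exceed \<open>2 * d * t\<close>. For
  \<open>A = V\<close> and \<open>F = {}\<close> this is the assumption on \<open>t\<close>; for
  \<open>A = {}\<close> it says \<open>t \<le> card F\<close>; trading \<open>2 * d\<close> vertices
  of \<open>A\<close> for one free variable leaves it unchanged. The factor 2 is spent at two
  places: a vertex may be freed only after most neighbours of another vertex have been deleted, and
  the colon by an edge can remove the neighbourhoods of both endpoints while freeing only one of
  them.\<close>

definition ring_ideal :: "'a::comm_ring_1 set \<Rightarrow> 'a set \<Rightarrow> bool" where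
  "ring_ideal C J \<longleftrightarrow> J \<subseteq> C \<and> 0 \<in> J \<and> (\<forall>x\<in>J. \<forall>y\<in>J. x + y \<in> J) \<and> (\<forall>a\<in>C. \<forall>x\<in>J. a * x \<in> J)"

definition adjoin :: "'a::comm_ring_1 set \<Rightarrow> 'a set \<Rightarrow> 'a \<Rightarrow> 'a set" where
  "adjoin C J f = {j + f * a | j a. j \<in> J \<and> a \<in> C}"

definition colon :: "'a::comm_ring_1 set \<Rightarrow> 'a set \<Rightarrow> 'a \<Rightarrow> 'a set" where
  "colon C J m = {p \<in> C. m * p \<in> J}"

definition nonzerodivisor_mod :: "'a::comm_ring_1 set \<Rightarrow> 'a set \<Rightarrow> 'a \<Rightarrow> bool" where
  "nonzerodivisor_mod C J f \<longleftrightarrow> (\<forall>p\<in>C. f * p \<in> J \<longrightarrow> p \<in> J)"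

fun ideal_plus :: "'a::comm_ring_1 set \<Rightarrow> 'a set \<Rightarrow> 'a list \<Rightarrow> 'a set" where
  "ideal_plus C J [] = J"
| "ideal_plus C J (f # fs) = ideal_plus C (adjoin C J f) fs"

text \<open>Properness is left out on purpose: a colon ideal met on the way may be the whole ring.
  It is established once, for the ideal of the theorem.\<close>

fun weakly_regular :: "'a::comm_ring_1 set \<Rightarrow> 'a set \<Rightarrow> 'a list \<Rightarrow> bool" where
  "weakly_regular C J [] \<longleftrightarrow> True"
| "weakly_regular C J (f # fs) \<longleftrightarrow> nonzerodivisor_mod C J f \<and> weakly_regular C (adjoin C J f) fs"

text \<open>\<open>C\<close> will be \<open>polys V\<close>. Taking it as a subset of a type class
  ring keeps the ordinary arithmetic of the simplifier; \<open>ideal_mpoly_ring_iff\<close> leads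
  back to ideals of the record \<open>mpoly_ring V\<close>.\<close>

locale unital_subring =
  fixes C :: "'a::comm_ring_1 set"
  assumes one_closed: "1 \<in> C"
    and add_closed: "\<And>x y. x \<in> C \<Longrightarrow> y \<in> C \<Longrightarrow> x + y \<in> C"
    and mult_closed: "\<And>x y. x \<in> C \<Longrightarrow> y \<in> C \<Longrightarrow> x * y \<in> C"
    and uminus_closed: "\<And>x. x \<in> C \<Longrightarrow> - x \<in> C"
begin

lemma zero_closed: "0 \<in> C"
  using add_closed[OF one_closed uminus_closed[OF one_closed]] by simp

lemma diff_closed: "x \<in> C \<Longrightarrow> y \<in> C \<Longrightarrow> x - y \<in> C"
  using add_closed[of x "- y"] uminus_closed by simp

lemma sum_closed: "(\<And>i. i \<in> A \<Longrightarrow> f i \<in> C) \<Longrightarrow> sum f A \<in> C"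
  by (induction A rule: infinite_finite_induct) (auto simp: zero_closed add_closed)

lemmas closed = one_closed zero_closed add_closed mult_closed uminus_closed diff_closed

context
  fixes J assumes J: "ring_ideal C J"
begin

lemma ideal_subset: "x \<in> J \<Longrightarrow> x \<in> C"
  using J by (auto simp: ring_ideal_def)

lemma ideal_zero: "0 \<in> J"
  using J by (auto simp: ring_ideal_def)

lemma ideal_add: "x \<in> J \<Longrightarrow> y \<in> J \<Longrightarrow> x + y \<in> J"
  using J by (auto simp: ring_ideal_def)

lemma ideal_mult: "a \<in> C \<Longrightarrow> x \<in> J \<Longrightarrow> a * x \<in> J"
  using J by (auto simp: ring_ideal_def)

lemma ideal_uminus: "x \<in> J \<Longrightarrow> - x \<in> J"
  using ideal_mult[OF uminus_closed[OF one_closed]] by fastforce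

lemma ideal_diff: "x \<in> J \<Longrightarrow> y \<in> J \<Longrightarrow> x - y \<in> J"
  using ideal_add[OF _ ideal_uminus, of x y] by simp

lemma ideal_sum: "(\<And>i. i \<in> A \<Longrightarrow> f i \<in> J) \<Longrightarrow> sum f A \<in> J"
  by (induction A rule: infinite_finite_induct) (auto simp: ideal_zero ideal_add)

lemma ideal_adjoin: "f \<in> C \<Longrightarrow> ring_ideal C (adjoin C J f)"
proof -
  assume f: "f \<in> C"
  have "x + y \<in> adjoin C J f" if xy: "x \<in> adjoin C J f" "y \<in> adjoin C J f" for x y
  proof -
    obtain j a j' a' where "x = j + f * a" "y = j' + f * a'" "j \<in> J" "j' \<in> J" "a \<in> C" "a' \<in> C"
      using xy unfolding adjoin_def by blast
    moreover have "x + y = (j + j') + f * (a + a')" using calculation by (simp add: algebra_simps)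
    ultimately show ?thesis unfolding adjoin_def using ideal_add closed by blast
  qed
  moreover have "b * x \<in> adjoin C J f" if xb: "x \<in> adjoin C J f" "b \<in> C" for x b
  proof -
    obtain j a where "x = j + f * a" "j \<in> J" "a \<in> C"
      using xb unfolding adjoin_def by blast
    moreover have "b * x = b * j + f * (b * a)" using calculation by (simp add: algebra_simps)
    ultimately show ?thesis unfolding adjoin_def using ideal_mult closed xb by blast
  qed
  moreover have "0 \<in> adjoin C J f"
    unfolding adjoin_def using ideal_zero zero_closed by force
  moreover have "adjoin C J f \<subseteq> C"
    unfolding adjoin_def using f ideal_subset closed by blast
  ultimately show ?thesis unfolding ring_ideal_def by blast
qed

lemma subset_adjoin: "J \<subseteq> adjoin C J f"
  unfolding adjoin_def using zero_closed by force

lemma adjoin_mult_mem: "a \<in> C \<Longrightarrow> f * a \<in> adjoin C J f"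
  unfolding adjoin_def using ideal_zero by force

text \<open>The snake lemma for multiplication by \<open>f\<close> on \<open>0 \<rightarrow> C/(J :
  m) \<rightarrow> C/J \<rightarrow> C/(J + m) \<rightarrow> 0\<close>: injectivity on the
  right-hand term keeps the sequence exact after reduction modulo \<open>f\<close>. Concretely,
  \<open>m * r = j + f * a\<close> puts \<open>f * a\<close> into \<open>J + m\<close>, hence
  \<open>a = j' + m * b\<close>, and \<open>r - f * b\<close> is the required element of the colon
  ideal.\<close>

lemma colon_adjoin:
  assumes mf: "m \<in> C" "f \<in> C" and nzd: "nonzerodivisor_mod C (adjoin C J m) f"
  shows "colon C (adjoin C J f) m = adjoin C (colon C J m) f"
proof (intro equalityI subsetI)
  fix r assume r: "r \<in> colon C (adjoin C J f) m"
  then obtain j a where ja: "m * r = j + f * a" "j \<in> J" "a \<in> C" "r \<in> C"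
    unfolding colon_def adjoin_def by blast
  have "f * a = - j + m * r" using ja by simp
  then have "f * a \<in> adjoin C J m" unfolding adjoin_def using ja ideal_uminus by blast
  then obtain j' b where b: "a = j' + m * b" "j' \<in> J" "b \<in> C"
    using nzd ja unfolding nonzerodivisor_mod_def adjoin_def by blast
  have "m * (r - f * b) = j + f * j'"
    using ja b by (simp add: algebra_simps)
  then have "r - f * b \<in> colon C J m"
    unfolding colon_def using ja b ideal_add ideal_mult mf closed by auto
  moreover have "r = (r - f * b) + f * b" by simp
  ultimately show "r \<in> adjoin C (colon C J m) f" unfolding adjoin_def using b by blast
next
  fix r assume "r \<in> adjoin C (colon C J m) f"
  then obtain j a where ja: "r = j + f * a" "m * j \<in> J" "j \<in> C" "a \<in> C"
    unfolding colon_def adjoin_def by blast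
  have "m * r = m * j + f * (m * a)" using ja by (simp add: algebra_simps)
  then have "m * r \<in> adjoin C J f" unfolding adjoin_def using ja mf closed by blast
  then show "r \<in> colon C (adjoin C J f) m" unfolding colon_def using ja mf closed by auto
qed

end

lemma adjoin_commute: "adjoin C (adjoin C J f) g = adjoin C (adjoin C J g) f"
proof -
  have "adjoin C (adjoin C J f) g \<subseteq> adjoin C (adjoin C J g) f" for f g
  proof
    fix x assume "x \<in> adjoin C (adjoin C J f) g"
    then obtain j a b where x: "x = (j + f * a) + g * b" "j \<in> J" "a \<in> C" "b \<in> C"
      unfolding adjoin_def by blast
    have "x = (j + g * b) + f * a" using x by (simp add: algebra_simps)
    then show "x \<in> adjoin C (adjoin C J g) f" unfolding adjoin_def using x by blast
  qed
  then show ?thesis by blast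
qed

lemma ideal_plus_adjoin: "ideal_plus C (adjoin C J f) fs = adjoin C (ideal_plus C J fs) f"
  by (induction fs arbitrary: J) (auto simp: adjoin_commute)

lemma ideal_plus_append: "ideal_plus C J (fs @ gs) = ideal_plus C (ideal_plus C J fs) gs"
  by (induction fs arbitrary: J) auto

lemma weakly_regular_append:
  "weakly_regular C J (fs @ gs) \<longleftrightarrow> weakly_regular C J fs \<and> weakly_regular C (ideal_plus C J fs) gs"
  by (induction fs arbitrary: J) auto

lemma ideal_ideal_plus: "ring_ideal C J \<Longrightarrow> set fs \<subseteq> C \<Longrightarrow> ring_ideal C (ideal_plus C J fs)"
  by (induction fs arbitrary: J) (auto simp: ideal_adjoin)

lemma subset_ideal_plus: "ring_ideal C J \<Longrightarrow> set fs \<subseteq> C \<Longrightarrow> J \<subseteq> ideal_plus C J fs"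
proof (induction fs arbitrary: J)
  case (Cons f fs)
  then show ?case using subset_adjoin[of J f] ideal_adjoin[of J f] by fastforce
qed auto

text \<open>The functor \<open>_ \<otimes> C/(fs)\<close> keeps \<open>0 \<rightarrow> C/(J : m) \<rightarrow> C/J \<rightarrow> C/(J + m) \<rightarrow> 0\<close> exact
  on the left if \<open>fs\<close> is weakly regular on the cokernel.\<close>

lemma colon_ideal_plus:
  assumes "ring_ideal C J" "m \<in> C" "set fs \<subseteq> C" "weakly_regular C (adjoin C J m) fs"
  shows "colon C (ideal_plus C J fs) m = ideal_plus C (colon C J m) fs"
  using assms
proof (induction fs arbitrary: J)
  case (Cons f fs)
  then have "weakly_regular C (adjoin C (adjoin C J f) m) fs"
    by (simp add: adjoin_commute[of J f m])
  then have "colon C (ideal_plus C (adjoin C J f) fs) m = ideal_plus C (colon C (adjoin C J f) m) fs"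
    using Cons ideal_adjoin by simp
  then show ?case using Cons.prems by (simp add: colon_adjoin)
qed auto

text \<open>An endomorphism of a short exact sequence that is injective on both ends is injective in
  the middle. By \<open>colon_adjoin\<close> the sequence modulo \<open>f\<close> has the same shape
  with \<open>J + f\<close> in place of \<open>J\<close>, so the argument can be repeated.\<close>

lemma weakly_regular_extension:
  assumes "ring_ideal C J" "m \<in> C" "set fs \<subseteq> C"
    and "weakly_regular C (colon C J m) fs" "weakly_regular C (adjoin C J m) fs"
  shows "weakly_regular C J fs"
  using assms
proof (induction fs arbitrary: J)
  case (Cons f fs)
  have f: "f \<in> C" "set fs \<subseteq> C" using Cons.prems by auto
  have "nonzerodivisor_mod C J f"
    unfolding nonzerodivisor_mod_def
  proof (intro ballI impI)
    fix p assume p: "p \<in> C" "f * p \<in> J"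
    then have "p \<in> adjoin C J m"
      using Cons.prems subset_adjoin[of J m] by (auto simp: nonzerodivisor_mod_def)
    then obtain j a where ja: "p = j + m * a" "j \<in> J" "a \<in> C" unfolding adjoin_def by blast
    have "m * (f * a) = f * p - f * j" using ja by (simp add: algebra_simps)
    then have "f * a \<in> colon C J m"
      unfolding colon_def using ja p Cons.prems ideal_diff ideal_mult closed by auto
    then have "a \<in> colon C J m"
      using Cons.prems ja by (auto simp: nonzerodivisor_mod_def)
    then show "p \<in> J" unfolding colon_def using ja Cons.prems ideal_add by auto
  qed
  moreover have "weakly_regular C (adjoin C J f) fs"
  proof (rule Cons.IH)
    show "weakly_regular C (colon C (adjoin C J f) m) fs"
      using Cons.prems by (simp add: colon_adjoin)
    show "weakly_regular C (adjoin C (adjoin C J f) m) fs"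
      using Cons.prems by (simp add: adjoin_commute[of J f m])
  qed (use Cons.prems ideal_adjoin in auto)
  ultimately show ?case by simp
qed auto

lemma weakly_regular_self: "set fs \<subseteq> C \<Longrightarrow> weakly_regular C C fs"
proof (induction fs)
  case (Cons f fs)
  have "ring_ideal C C" by (auto simp: ring_ideal_def closed)
  then have "adjoin C C f = C"
    using subset_adjoin[of C f] Cons.prems ideal_adjoin[of C f] by (auto simp: ring_ideal_def)
  then show ?case using Cons by (auto simp: nonzerodivisor_mod_def)
qed auto

lemma weakly_regular_iff_nth:
  "weakly_regular C J fs \<longleftrightarrow> (\<forall>i < length fs. nonzerodivisor_mod C (ideal_plus C J (take i fs)) (fs ! i))"
  by (induction fs arbitrary: J) (auto simp: All_less_Suc2)

text \<open>Links the recursion, which suits induction, to the finite sums by which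
  \<open>seq_submodule\<close> is defined.\<close>

lemma ideal_plus_eq_sums:
  assumes "ring_ideal C J"
  shows "ideal_plus C J fs = {j + (\<Sum>i<length fs. fs ! i * a i) | j a. j \<in> J \<and> a \<in> {..<length fs} \<rightarrow> C}"
proof (induction fs rule: rev_induct)
  case (snoc f fs)
  have "ideal_plus C J (fs @ [f]) = adjoin C (ideal_plus C J fs) f" by (simp add: ideal_plus_append)
  also have "\<dots> = {j + (\<Sum>i<length (fs @ [f]). (fs @ [f]) ! i * a i) | j a. j \<in> J \<and> a \<in> {..<length (fs @ [f])} \<rightarrow> C}"
    (is "?L = ?R")
  proof (intro equalityI subsetI)
    fix x assume "x \<in> ?L"
    then obtain j a b where x: "x = (j + (\<Sum>i<length fs. fs ! i * a i)) + f * b" "j \<in> J"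
      "a \<in> {..<length fs} \<rightarrow> C" "b \<in> C" unfolding snoc adjoin_def by blast
    have "x = j + (\<Sum>i<length (fs @ [f]). (fs @ [f]) ! i * (a(length fs := b)) i)"
      using x by (simp add: nth_append algebra_simps)
    moreover have "a(length fs := b) \<in> {..<length (fs @ [f])} \<rightarrow> C" using x by (auto simp: less_Suc_eq)
    ultimately show "x \<in> ?R" using x by blast
  next
    fix x assume "x \<in> ?R"
    then obtain j a where x: "x = j + (\<Sum>i<length (fs @ [f]). (fs @ [f]) ! i * a i)" "j \<in> J"
      "a \<in> {..<length (fs @ [f])} \<rightarrow> C" by blast
    have "x = (j + (\<Sum>i<length fs. fs ! i * a i)) + f * a (length fs)"
      using x by (simp add: nth_append algebra_simps)
    moreover have "a \<in> {..<length fs} \<rightarrow> C" "a (length fs) \<in> C" using x by auto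
    ultimately show "x \<in> ?L" unfolding snoc adjoin_def using x by blast
  qed
  finally show ?case .
qed simp

end


section \<open>Polynomials in a set of variables and multiplication by monomials\<close>

definition polys :: "'v set \<Rightarrow> (('v \<Rightarrow>\<^sub>0 nat) \<Rightarrow>\<^sub>0 'k::comm_ring_1) set" where
  "polys V = carrier (mpoly_ring V)"

abbreviation monom :: "('v \<Rightarrow>\<^sub>0 nat) \<Rightarrow> ('v \<Rightarrow>\<^sub>0 nat) \<Rightarrow>\<^sub>0 'k::comm_ring_1" where
  "monom a \<equiv> Poly_Mapping.single a 1"

lemma mem_polys_iff: "p \<in> polys V \<longleftrightarrow> (\<forall>m \<in> Poly_Mapping.keys p. Poly_Mapping.keys m \<subseteq> V)"
  by (simp add: polys_def mpoly_ring_def)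

lemma unital_subring_polys: "unital_subring (polys V :: (('v \<Rightarrow>\<^sub>0 nat) \<Rightarrow>\<^sub>0 'k::comm_ring_1) set)"
proof
  let ?R = "mpoly_ring V :: (('v \<Rightarrow>\<^sub>0 nat) \<Rightarrow>\<^sub>0 'k) ring"
  have R: "cring ?R" by (rule cring_mpoly_ring)
  fix x y :: "('v \<Rightarrow>\<^sub>0 nat) \<Rightarrow>\<^sub>0 'k"
  assume "x \<in> polys V" "y \<in> polys V"
  then have xy: "x \<in> carrier ?R" "y \<in> carrier ?R" by (simp_all add: polys_def)
  have "x \<oplus>\<^bsub>?R\<^esub> y \<in> carrier ?R" "x \<otimes>\<^bsub>?R\<^esub> y \<in> carrier ?R"
    using xy cring.axioms(1)[OF R] by (simp_all add: ring.ring_simprules)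
  then show "x + y \<in> polys V" "x * y \<in> polys V"
    by (simp_all add: polys_def mpoly_ring_def)
qed (auto simp: mem_polys_iff)

lemma keys_add_nat: "Poly_Mapping.keys (m + n :: 'v \<Rightarrow>\<^sub>0 nat) = Poly_Mapping.keys m \<union> Poly_Mapping.keys n"
  by (auto simp: in_keys_iff lookup_add)

lemma poly_expansion: "(\<Sum>m\<in>Poly_Mapping.keys p. Poly_Mapping.single m (Poly_Mapping.lookup p m)) = p"
  by (rule poly_mapping_eqI) (auto simp: lookup_sum lookup_single when_def in_keys_iff)

lemma monom_mult_expansion:
  fixes p :: "('v \<Rightarrow>\<^sub>0 nat) \<Rightarrow>\<^sub>0 'k::comm_ring_1"
  shows "monom a * p = (\<Sum>m\<in>Poly_Mapping.keys p. Poly_Mapping.single (a + m) (Poly_Mapping.lookup p m))"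
proof -
  have "monom a * p = monom a * (\<Sum>m\<in>Poly_Mapping.keys p. Poly_Mapping.single m (Poly_Mapping.lookup p m))"
    by (simp only: poly_expansion)
  also have "\<dots> = (\<Sum>m\<in>Poly_Mapping.keys p. Poly_Mapping.single (a + m) (Poly_Mapping.lookup p m))"
    by (simp add: sum_distrib_left mult_single)
  finally show ?thesis .
qed

lemma lookup_monom_mult:
  fixes p :: "('v \<Rightarrow>\<^sub>0 nat) \<Rightarrow>\<^sub>0 'k::comm_ring_1"
  shows "Poly_Mapping.lookup (monom a * p) (a + m) = Poly_Mapping.lookup p m"
  by (auto simp: monom_mult_expansion lookup_sum lookup_single when_def in_keys_iff)

text \<open>Adding \<open>a\<close> is injective on exponents, so no terms cancel and the general
  inclusion \<open>keys_mult\<close> becomes an equality.\<close>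

lemma keys_monom_mult:
  fixes p :: "('v \<Rightarrow>\<^sub>0 nat) \<Rightarrow>\<^sub>0 'k::comm_ring_1"
  shows "Poly_Mapping.keys (monom a * p) = (+) a ` Poly_Mapping.keys p"
proof
  show "Poly_Mapping.keys (monom a * p) \<subseteq> (+) a ` Poly_Mapping.keys p"
    using keys_mult[of "monom a" p] by (auto split: if_splits)
  show "(+) a ` Poly_Mapping.keys p \<subseteq> Poly_Mapping.keys (monom a * p)"
    by (auto simp: in_keys_iff lookup_monom_mult)
qed

lemma monom_in_polys: "Poly_Mapping.keys a \<subseteq> V \<Longrightarrow> monom a \<in> polys V"
  by (simp add: mem_polys_iff)

lemma single_in_polys: "Poly_Mapping.keys a \<subseteq> V \<Longrightarrow> Poly_Mapping.single a c \<in> polys V"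
  by (simp add: mem_polys_iff)

lemma mvar_in_polys: "v \<in> V \<Longrightarrow> mvar v \<in> polys V"
  by (simp add: mvar_def monom_in_polys)


section \<open>Monomial ideals\<close>

text \<open>Given by its set of exponents instead of generators: adjoining a monomial is then a
  union and taking a colon a preimage under translation. Only the exponents in \<open>U\<close> that
  are supported in \<open>V\<close> matter.\<close>

definition monom_ideal :: "'v set \<Rightarrow> ('v \<Rightarrow>\<^sub>0 nat) set \<Rightarrow> (('v \<Rightarrow>\<^sub>0 nat) \<Rightarrow>\<^sub>0 'k::comm_ring_1) set" where
  "monom_ideal V U = {p \<in> polys V. Poly_Mapping.keys p \<subseteq> U}"

definition up_closed :: "('v \<Rightarrow>\<^sub>0 nat) set \<Rightarrow> bool" where
  "up_closed U \<longleftrightarrow> (\<forall>a\<in>U. \<forall>b. a + b \<in> U)"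

lemma monom_ideal_cong:
  "(\<And>a. Poly_Mapping.keys a \<subseteq> V \<Longrightarrow> a \<in> U \<longleftrightarrow> a \<in> U') \<Longrightarrow> monom_ideal V U = monom_ideal V U'"
  by (auto simp: monom_ideal_def mem_polys_iff)

lemma ring_ideal_monom_ideal: "up_closed U \<Longrightarrow> ring_ideal (polys V) (monom_ideal V U)"
proof -
  assume U: "up_closed U"
  interpret unital_subring "polys V" by (rule unital_subring_polys)
  have "Poly_Mapping.keys (a * x) \<subseteq> U" if x: "Poly_Mapping.keys x \<subseteq> U" for a x :: "('a \<Rightarrow>\<^sub>0 nat) \<Rightarrow>\<^sub>0 'b"
  proof
    fix m assume "m \<in> Poly_Mapping.keys (a * x)"
    then obtain b c where "m = b + c" "c \<in> Poly_Mapping.keys x" using keys_mult[of a x] by blast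
    then show "m \<in> U" using x U unfolding up_closed_def by (metis add.commute subsetD)
  qed
  moreover have "Poly_Mapping.keys (x + y) \<subseteq> U"
    if "Poly_Mapping.keys x \<subseteq> U" "Poly_Mapping.keys y \<subseteq> U" for x y :: "('a \<Rightarrow>\<^sub>0 nat) \<Rightarrow>\<^sub>0 'b"
    using that keys_add[of x y] by blast
  ultimately show ?thesis
    unfolding ring_ideal_def monom_ideal_def by (auto simp: closed)
qed

lemma single_in_monom_ideal:
  "Poly_Mapping.keys a \<subseteq> V \<Longrightarrow> a \<in> U \<Longrightarrow> Poly_Mapping.single a c \<in> monom_ideal V U"
  by (simp add: monom_ideal_def single_in_polys)

lemma adjoin_monom_ideal:
  assumes U: "up_closed U" and a: "Poly_Mapping.keys a \<subseteq> V"
  shows "adjoin (polys V) (monom_ideal V U) (monom a) = monom_ideal V (U \<union> range ((+) a))"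
    (is "?L = ?R")
proof
  interpret unital_subring "polys V" by (rule unital_subring_polys)
  have J: "ring_ideal (polys V) (monom_ideal V U)" using U by (rule ring_ideal_monom_ideal)
  have "up_closed (U \<union> range ((+) a))"
    using U unfolding up_closed_def by (auto simp: add.assoc)
  then have J': "ring_ideal (polys V) ?R" by (rule ring_ideal_monom_ideal)
  show "?L \<subseteq> ?R"
  proof
    fix x assume "x \<in> ?L"
    then obtain j q where x: "x = j + monom a * q" "j \<in> monom_ideal V U" "q \<in> polys V"
      unfolding adjoin_def by blast
    have "monom a * q \<in> ?R"
      using x a by (auto simp: monom_ideal_def keys_monom_mult mult_closed monom_in_polys)
    moreover have "j \<in> ?R" using x by (auto simp: monom_ideal_def)
    ultimately show "x \<in> ?R" using ideal_add[OF J'] x by blast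
  qed
  show "?R \<subseteq> ?L"
  proof
    fix p assume p: "p \<in> ?R"
    have "Poly_Mapping.single m c \<in> ?L" if m: "m \<in> Poly_Mapping.keys p" for m c
    proof -
      have mV: "Poly_Mapping.keys m \<subseteq> V" using p m by (auto simp: monom_ideal_def mem_polys_iff)
      show ?thesis
      proof (cases "m \<in> U")
        case True
        then show ?thesis using subset_adjoin[OF J] mV single_in_monom_ideal by blast
      next
        case False
        then obtain b where b: "m = a + b" using p m by (auto simp: monom_ideal_def)
        have "Poly_Mapping.single m c = monom a * Poly_Mapping.single b c" using b by (simp add: mult_single)
        moreover have "Poly_Mapping.single b c \<in> polys V"
          using mV b by (intro single_in_polys) (simp add: keys_add_nat)
        ultimately show ?thesis using adjoin_mult_mem[OF J] by simp
      qed
    qed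
    then have "(\<Sum>m\<in>Poly_Mapping.keys p. Poly_Mapping.single m (Poly_Mapping.lookup p m)) \<in> ?L"
      by (intro ideal_sum[OF ideal_adjoin[OF J]] monom_in_polys a)
    then show "p \<in> ?L" by (simp add: poly_expansion)
  qed
qed

lemma colon_monom_ideal:
  assumes a: "Poly_Mapping.keys a \<subseteq> V"
  shows "colon (polys V) (monom_ideal V U) (monom a) = monom_ideal V {b. a + b \<in> U}"
proof -
  interpret unital_subring "polys V" by (rule unital_subring_polys)
  show ?thesis using a
    by (auto simp: colon_def monom_ideal_def keys_monom_mult mult_closed monom_in_polys)
qed


section \<open>Stanley-Reisner ideals\<close>

text \<open>For \<open>\<Delta> = Pow F\<close> with \<open>F \<subseteq> V\<close> this is the
  ideal of the variables outside \<open>F\<close>, with quotient \<open>K[F]\<close>; the empty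
  family gives the whole ring.\<close>

definition nonface_ideal :: "'v set \<Rightarrow> 'v set set \<Rightarrow> (('v \<Rightarrow>\<^sub>0 nat) \<Rightarrow>\<^sub>0 'k::comm_ring_1) set" where
  "nonface_ideal V \<Delta> = monom_ideal V {a. Poly_Mapping.keys a \<notin> \<Delta>}"

definition down_closed :: "'v set set \<Rightarrow> bool" where
  "down_closed \<Delta> \<longleftrightarrow> (\<forall>s\<in>\<Delta>. \<forall>t\<subseteq>s. t \<in> \<Delta>)"

lemma nonface_ideal_cong:
  "(\<And>s. s \<subseteq> V \<Longrightarrow> s \<in> \<Delta> \<longleftrightarrow> s \<in> \<Gamma>) \<Longrightarrow> nonface_ideal V \<Delta> = nonface_ideal V \<Gamma>"
  unfolding nonface_ideal_def by (rule monom_ideal_cong) auto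

lemma up_closed_nonfaces: "down_closed \<Delta> \<Longrightarrow> up_closed {a. Poly_Mapping.keys a \<notin> \<Delta>}"
  unfolding up_closed_def down_closed_def by (auto simp: keys_add_nat)

lemma ring_ideal_nonface_ideal: "down_closed \<Delta> \<Longrightarrow> ring_ideal (polys V) (nonface_ideal V \<Delta>)"
  unfolding nonface_ideal_def by (intro ring_ideal_monom_ideal up_closed_nonfaces)

lemma range_add_single: "range ((+) (Poly_Mapping.single v 1)) = {a::'v \<Rightarrow>\<^sub>0 nat. v \<in> Poly_Mapping.keys a}"
proof (intro equalityI subsetI)
  fix a :: "'v \<Rightarrow>\<^sub>0 nat" assume "a \<in> {a. v \<in> Poly_Mapping.keys a}"
  then have "a = Poly_Mapping.single v 1 + (a - Poly_Mapping.single v 1)"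
    by (intro poly_mapping_eqI) (auto simp: lookup_add lookup_minus lookup_single when_def in_keys_iff)
  then show "a \<in> range ((+) (Poly_Mapping.single v 1))" by blast
qed (auto simp: keys_add_nat)

lemma adjoin_nonface_ideal:
  assumes "down_closed \<Delta>" "v \<in> V"
  shows "adjoin (polys V) (nonface_ideal V \<Delta>) (mvar v) = nonface_ideal V {s \<in> \<Delta>. v \<notin> s}"
proof -
  have v: "Poly_Mapping.keys (Poly_Mapping.single v 1 :: 'a \<Rightarrow>\<^sub>0 nat) \<subseteq> V" using assms by simp
  show ?thesis
    unfolding nonface_ideal_def mvar_def adjoin_monom_ideal[OF up_closed_nonfaces[OF assms(1)] v]
      range_add_single
    by (intro monom_ideal_cong) auto
qed

text \<open>The complex is the closed star of \<open>v\<close> rather than its link: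
  \<open>v\<close> stays a variable and is free from now on.\<close>

lemma colon_nonface_ideal:
  assumes "v \<in> V"
  shows "colon (polys V) (nonface_ideal V \<Delta>) (mvar v) = nonface_ideal V {s. insert v s \<in> \<Delta>}"
  unfolding nonface_ideal_def mvar_def
  using assms by (simp add: colon_monom_ideal keys_add_nat)


section \<open>Homogeneous components\<close>

text \<open>With all variables this is the degree. With a smaller set \<open>C\<close> it is the
  order of a monomial along the prime generated by \<open>C\<close>, which is how symbolic powers
  are described below.\<close>

definition weight :: "'v set \<Rightarrow> ('v \<Rightarrow>\<^sub>0 nat) \<Rightarrow> nat" where
  "weight V m = (\<Sum>v\<in>V. Poly_Mapping.lookup m v)"

lemma weight_add: "weight V (m + n) = weight V m + weight V n"
  by (simp add: weight_def lookup_add sum.distrib)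

definition homogeneous :: "'v set \<Rightarrow> nat \<Rightarrow> (('v \<Rightarrow>\<^sub>0 nat) \<Rightarrow>\<^sub>0 'k::comm_ring_1) \<Rightarrow> bool" where
  "homogeneous V d p \<longleftrightarrow> (\<forall>m\<in>Poly_Mapping.keys p. weight V m = d)"

definition hom_part :: "'v set \<Rightarrow> nat \<Rightarrow> (('v \<Rightarrow>\<^sub>0 nat) \<Rightarrow>\<^sub>0 'k::comm_ring_1) \<Rightarrow> ('v \<Rightarrow>\<^sub>0 nat) \<Rightarrow>\<^sub>0 'k" where
  "hom_part V d p = (\<Sum>m | m \<in> Poly_Mapping.keys p \<and> weight V m = d. Poly_Mapping.single m (Poly_Mapping.lookup p m))"

lemma lookup_hom_part: "Poly_Mapping.lookup (hom_part V d p) m = (if weight V m = d then Poly_Mapping.lookup p m else 0)"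
  by (auto simp: hom_part_def lookup_sum lookup_single when_def in_keys_iff)

lemma hom_part_add: "hom_part V d (p + q) = hom_part V d p + hom_part V d q"
  by (rule poly_mapping_eqI) (simp add: lookup_hom_part lookup_add)

lemma hom_part_sum: "hom_part V d (sum f A) = (\<Sum>i\<in>A. hom_part V d (f i))"
  by (rule poly_mapping_eqI) (simp add: lookup_hom_part lookup_sum)

lemma hom_part_homogeneous: "homogeneous V e p \<Longrightarrow> hom_part V d p = (if d = e then p else 0)"
  by (rule poly_mapping_eqI) (auto simp: lookup_hom_part homogeneous_def in_keys_iff)

lemma homogeneous_mult:
  assumes "homogeneous V d p" "homogeneous V e q"
  shows "homogeneous V (d + e) (p * q)"
  unfolding homogeneous_def
proof
  fix m assume "m \<in> Poly_Mapping.keys (p * q)"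
  then obtain a b where "m = a + b" "a \<in> Poly_Mapping.keys p" "b \<in> Poly_Mapping.keys q"
    using keys_mult[of p q] by blast
  then show "weight V m = d + e" using assms by (simp add: homogeneous_def weight_add)
qed

lemma homogeneous_sum:
  assumes "\<And>i. i \<in> A \<Longrightarrow> homogeneous V d (f i)"
  shows "homogeneous V d (sum f A)"
  using assms keys_sum[of f A] unfolding homogeneous_def by blast

lemma hom_part_mult:
  assumes f: "homogeneous V e f"
  shows "hom_part V d (f * p) = (if e \<le> d then f * hom_part V (d - e) p else 0)"
proof -
  let ?s = "\<lambda>m. Poly_Mapping.single m (Poly_Mapping.lookup p m)"
  have "homogeneous V (e + weight V m) (f * ?s m)" for m
    by (intro homogeneous_mult f) (auto simp: homogeneous_def)
  then have s: "hom_part V d (f * ?s m) = (if d = e + weight V m then f * ?s m else 0)" for m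
    by (rule hom_part_homogeneous)
  have "hom_part V d (f * p) = hom_part V d (f * (\<Sum>m\<in>Poly_Mapping.keys p. ?s m))"
    by (simp add: poly_expansion)
  also have "\<dots> = (\<Sum>m\<in>Poly_Mapping.keys p. if d = e + weight V m then f * ?s m else 0)"
    by (simp add: sum_distrib_left hom_part_sum s)
  also have "\<dots> = (\<Sum>m | m \<in> Poly_Mapping.keys p \<and> d = e + weight V m. f * ?s m)"
    by (simp add: sum.inter_filter)
  also have "\<dots> = (if e \<le> d then f * hom_part V (d - e) p else 0)"
  proof (cases "e \<le> d")
    case True
    then have "(d = e + w) = (w = d - e)" for w by auto
    then show ?thesis using True by (simp add: hom_part_def sum_distrib_left)
  next
    case False
    then have "{m. m \<in> Poly_Mapping.keys p \<and> d = e + weight V m} = {}" by auto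
    then show ?thesis using False by simp
  qed
  finally show ?thesis .
qed

lemma hom_part_expansion:
  obtains D where "p = (\<Sum>d<D. hom_part V d p)"
proof -
  \<comment> \<open>For \<open>p = 0\<close> the maximum of the empty set has no meaning, but then
    there is no key to bound.\<close>
  define D where "D = Suc (Max (weight V ` Poly_Mapping.keys p))"
  have "weight V m < D" if "m \<in> Poly_Mapping.keys p" for m
    unfolding D_def using that by (intro le_imp_less_Suc Max_ge) auto
  then have "p = (\<Sum>d<D. hom_part V d p)"
    by (intro poly_mapping_eqI) (auto simp: lookup_sum lookup_hom_part in_keys_iff)
  then show ?thesis by (rule that)
qed

lemma hom_part_in_polys: "p \<in> polys V \<Longrightarrow> hom_part W d p \<in> polys V"
  by (auto simp: mem_polys_iff in_keys_iff lookup_hom_part split: if_splits)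

definition homogeneous_ideal :: "'v set \<Rightarrow> (('v \<Rightarrow>\<^sub>0 nat) \<Rightarrow>\<^sub>0 'k::comm_ring_1) set \<Rightarrow> bool" where
  "homogeneous_ideal V J \<longleftrightarrow> ring_ideal (polys V) J \<and> (\<forall>p\<in>J. \<forall>d. hom_part V d p \<in> J)"

lemma homogeneous_ideal_monom_ideal: "up_closed U \<Longrightarrow> homogeneous_ideal V (monom_ideal V U)"
  unfolding homogeneous_ideal_def
  by (auto simp: ring_ideal_monom_ideal)
     (auto simp: monom_ideal_def hom_part_in_polys in_keys_iff lookup_hom_part split: if_splits)

lemma homogeneous_ideal_adjoin:
  assumes J: "homogeneous_ideal V J" and f: "homogeneous V e f" "f \<in> polys V"
  shows "homogeneous_ideal V (adjoin (polys V) J f)"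
proof -
  interpret unital_subring "polys V" by (rule unital_subring_polys)
  have "hom_part V d (j + f * a) \<in> adjoin (polys V) J f" if "j \<in> J" "a \<in> polys V" for j a d
  proof -
    have j: "hom_part V d j \<in> J" using J that unfolding homogeneous_ideal_def by blast
    show ?thesis
    proof (cases "e \<le> d")
      case True
      then show ?thesis
        unfolding hom_part_add hom_part_mult[OF f(1)] adjoin_def
        using j hom_part_in_polys[OF that(2)] by auto
    next
      case False
      then show ?thesis
        unfolding hom_part_add hom_part_mult[OF f(1)]
        using j subset_adjoin J unfolding homogeneous_ideal_def by auto
    qed
  qed
  then have "\<forall>p\<in>adjoin (polys V) J f. \<forall>d. hom_part V d p \<in> adjoin (polys V) J f"
    unfolding adjoin_def[of _ J f] by blast
  then show ?thesis
    using J f(2) ideal_adjoin[of J f] unfolding homogeneous_ideal_def by blast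
qed

lemma homogeneous_ideal_ideal_plus:
  assumes "homogeneous_ideal V J" "\<And>f. f \<in> set fs \<Longrightarrow> f \<in> polys V \<and> (\<exists>e. homogeneous V e f)"
  shows "homogeneous_ideal V (ideal_plus (polys V) J fs)"
  using assms
proof (induction fs arbitrary: J)
  case (Cons f fs)
  then show ?case using homogeneous_ideal_adjoin[of V J _ f] by fastforce
qed simp

lemma homogeneous_mvar: "v \<in> V \<Longrightarrow> finite V \<Longrightarrow> homogeneous V 1 (mvar v)"
  by (auto simp: homogeneous_def mvar_def weight_def lookup_single when_def)

lemma homogeneous_one: "homogeneous V 0 1"
  by (auto simp: homogeneous_def weight_def)

lemma homogeneous_power: "homogeneous V d p \<Longrightarrow> homogeneous V (N * d) (p ^ N)"
proof (induction N)
  case (Suc N)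
  then show ?case using homogeneous_mult[of V d p "N * d" "p ^ N"] by simp
qed (simp add: homogeneous_one)

lemma homogeneous_prod:
  assumes "finite T" "\<And>v. v \<in> T \<Longrightarrow> homogeneous V 1 (f v)"
  shows "homogeneous V (card T) (prod f T)"
  using assms
proof (induction T rule: finite_induct)
  case (insert v T)
  then show ?case using homogeneous_mult[of V 1 "f v" "card T" "prod f T"] by simp
qed (simp add: homogeneous_one)

text \<open>A graded form of Krull's intersection theorem. A multiple of \<open>x ^ Suc d\<close>
  has no component of degree \<open>d\<close>, so the component of \<open>p\<close> of degree
  \<open>d\<close> comes from \<open>J\<close> alone.\<close>

lemma homogeneous_ideal_separated:
  assumes J: "homogeneous_ideal V J" and x: "homogeneous V 1 x"
    and p: "\<And>N. p \<in> adjoin (polys V) J (x ^ N)"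
  shows "p \<in> J"
proof -
  interpret unital_subring "polys V" by (rule unital_subring_polys)
  have "hom_part V d p \<in> J" for d
  proof -
    obtain j a where ja: "p = j + x ^ Suc d * a" "j \<in> J" using p[of "Suc d"] unfolding adjoin_def by blast
    have h: "homogeneous V (Suc d) (x ^ Suc d)" using homogeneous_power[OF x, of "Suc d"] by simp
    have "hom_part V d p = hom_part V d j"
      by (simp add: ja(1) hom_part_add hom_part_mult[OF h] del: power_Suc)
    then show ?thesis using J ja unfolding homogeneous_ideal_def by simp
  qed
  then have sum: "(\<Sum>d<D. hom_part V d p) \<in> J" for D
    using J ideal_sum[of J "{..<D}" "\<lambda>d. hom_part V d p"] unfolding homogeneous_ideal_def by blast
  obtain D where D: "p = (\<Sum>d<D. hom_part V d p)" by (rule hom_part_expansion)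
  show ?thesis using sum[of D] unfolding D[symmetric] .
qed


section \<open>Elementary symmetric polynomials\<close>

definition elem_sym :: "'v set \<Rightarrow> nat \<Rightarrow> ('v \<Rightarrow>\<^sub>0 nat) \<Rightarrow>\<^sub>0 'k::comm_ring_1" where
  "elem_sym V i = (\<Sum>T | T \<subseteq> V \<and> card T = i. \<Prod>v\<in>T. mvar v)"

text \<open>The degrees run from 1 to \<open>t\<close>; in degree 0 the polynomial would be the
  constant 1 for finite \<open>V\<close>.\<close>

definition elem_syms :: "'v set \<Rightarrow> nat \<Rightarrow> (('v \<Rightarrow>\<^sub>0 nat) \<Rightarrow>\<^sub>0 'k::comm_ring_1) list" where
  "elem_syms V t = map (elem_sym V) [1..<Suc t]"

lemma elem_syms_0 [simp]: "elem_syms V 0 = []"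
  by (simp add: elem_syms_def)

lemma elem_syms_Suc: "elem_syms V (Suc t) = elem_syms V t @ [elem_sym V (Suc t)]"
  by (simp add: elem_syms_def)

lemma prod_mvar_in_polys: "T \<subseteq> V \<Longrightarrow> (\<Prod>v\<in>T. mvar v) \<in> polys V"
proof -
  interpret unital_subring "polys V" by (rule unital_subring_polys)
  show "T \<subseteq> V \<Longrightarrow> (\<Prod>v\<in>T. mvar v) \<in> polys V"
    by (induction T rule: infinite_finite_induct) (auto simp: closed mvar_in_polys)
qed

lemma elem_sym_in_polys: "elem_sym V i \<in> polys V"
proof -
  interpret unital_subring "polys V" by (rule unital_subring_polys)
  show ?thesis unfolding elem_sym_def by (intro sum_closed prod_mvar_in_polys) auto
qed

lemma homogeneous_elem_sym:
  assumes "finite V"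
  shows "homogeneous V i (elem_sym V i)"
  unfolding elem_sym_def
proof (rule homogeneous_sum)
  fix T assume "T \<in> {T. T \<subseteq> V \<and> card T = i}"
  then have T: "T \<subseteq> V" "card T = i" by auto
  have "homogeneous V (card T) (\<Prod>v\<in>T. mvar v)"
    using T finite_subset[OF T(1) assms] by (intro homogeneous_prod homogeneous_mvar assms) auto
  then show "homogeneous V i (\<Prod>v\<in>T. mvar v)" using T by simp
qed

lemma nonzerodivisor_mod_prod:
  assumes "unital_subring C" "finite T" "\<And>v. v \<in> T \<Longrightarrow> nonzerodivisor_mod C J (f v)" "\<And>v. v \<in> T \<Longrightarrow> f v \<in> C"
  shows "nonzerodivisor_mod C J (prod f T)"
proof -
  interpret unital_subring C by fact
  have "prod f T \<in> C \<and> nonzerodivisor_mod C J (prod f T)"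
    using assms(2-)
  proof (induction T rule: finite_induct)
    case (insert v T)
    have T: "prod f T \<in> C" "nonzerodivisor_mod C J (prod f T)"
      using insert.IH insert.prems by simp_all
    have v: "nonzerodivisor_mod C J (f v)" "f v \<in> C"
      using insert.prems by simp_all
    have "nonzerodivisor_mod C J (f v * prod f T)"
      unfolding nonzerodivisor_mod_def mult.assoc
    proof (intro ballI impI)
      fix p assume p: "p \<in> C" "f v * (prod f T * p) \<in> J"
      have "prod f T * p \<in> C" using T(1) p(1) by (rule mult_closed)
      then have "prod f T * p \<in> J" using p v unfolding nonzerodivisor_mod_def by blast
      then show "p \<in> J" using p T unfolding nonzerodivisor_mod_def by blast
    qed
    moreover have "f v * prod f T \<in> C" using v(2) T(1) by (rule mult_closed)
    ultimately show ?case unfolding prod.insert[OF insert.hyps] by blast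
  qed (simp add: nonzerodivisor_mod_def one_closed)
  then show ?thesis by blast
qed

lemma down_closed_Pow: "down_closed (Pow F)"
  by (auto simp: down_closed_def)

lemma elem_syms_in_polys: "set (elem_syms V t) \<subseteq> polys V"
  by (auto simp: elem_syms_def elem_sym_in_polys)

section \<open>Elementary symmetric polynomials on the coordinate rings \<open>K[F]\<close>\<close>

context
  fixes V :: "'v set"
  assumes fin: "finite V"
begin

interpretation unital_subring "polys V :: (('v \<Rightarrow>\<^sub>0 nat) \<Rightarrow>\<^sub>0 'k::comm_ring_1) set" by (rule unital_subring_polys)

private abbreviation (input) PF :: "'v set \<Rightarrow> (('v \<Rightarrow>\<^sub>0 nat) \<Rightarrow>\<^sub>0 'k::comm_ring_1) set" where
  "PF F \<equiv> nonface_ideal V (Pow F)"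

lemma adjoin_face: "v \<in> F \<Longrightarrow> F \<subseteq> V \<Longrightarrow> adjoin (polys V) (PF F) (mvar v) = PF (F - {v})"
  by (subst adjoin_nonface_ideal) (auto simp: down_closed_Pow intro!: nonface_ideal_cong)

lemma colon_face: "v \<in> F \<Longrightarrow> F \<subseteq> V \<Longrightarrow> colon (polys V) (PF F) (mvar v) = PF F"
  by (subst colon_nonface_ideal) (auto intro!: nonface_ideal_cong)

text \<open>The variable is a nonzerodivisor on \<open>K[F]\<close>, that is, the colon ideal does
  not grow. By \<open>colon_ideal_plus\<close> this survives reduction modulo the sequence as soon
  as the sequence is weakly regular on \<open>K[F]/(x)\<close>, the coordinate ring of
  \<open>F - {v}\<close>.\<close>

lemma mvar_nonzerodivisor_face:
  assumes "F \<subseteq> V" "v \<in> F" "weakly_regular (polys V) (PF (F - {v})) (elem_syms V t :: (('v \<Rightarrow>\<^sub>0 nat) \<Rightarrow>\<^sub>0 'k::comm_ring_1) list)"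
  shows "nonzerodivisor_mod (polys V) (ideal_plus (polys V) (PF F) (elem_syms V t)) (mvar v :: ('v \<Rightarrow>\<^sub>0 nat) \<Rightarrow>\<^sub>0 'k::comm_ring_1)"
proof -
  have "colon (polys V) (ideal_plus (polys V) (PF F) (elem_syms V t)) (mvar v :: ('v \<Rightarrow>\<^sub>0 nat) \<Rightarrow>\<^sub>0 'k)
      = ideal_plus (polys V) (colon (polys V) (PF F) (mvar v)) (elem_syms V t)"
    using assms
    by (intro colon_ideal_plus ring_ideal_nonface_ideal down_closed_Pow elem_syms_in_polys)
      (auto simp: adjoin_face intro: mvar_in_polys)
  also have "\<dots> = ideal_plus (polys V) (PF F) (elem_syms V t)"
    by (simp only: colon_face[OF assms(2,1)])
  finally show ?thesis unfolding nonzerodivisor_mod_def colon_def by blast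
qed

text \<open>Every other \<open>i\<close>-element subset of \<open>V\<close> contains a variable
  outside \<open>F\<close>, which vanishes on \<open>K[F]\<close>.\<close>

lemma elem_sym_minus_prod_in_face:
  assumes F: "F \<subseteq> V" "card F = i"
  shows "elem_sym V i - (\<Prod>v\<in>F. mvar v) \<in> (PF F :: (('v \<Rightarrow>\<^sub>0 nat) \<Rightarrow>\<^sub>0 'k::comm_ring_1) set)"
proof -
  have J: "ring_ideal (polys V) (PF F :: (('v \<Rightarrow>\<^sub>0 nat) \<Rightarrow>\<^sub>0 'k) set)" by (intro ring_ideal_nonface_ideal down_closed_Pow)
  have "(\<Prod>v\<in>T. mvar v) \<in> (PF F :: (('v \<Rightarrow>\<^sub>0 nat) \<Rightarrow>\<^sub>0 'k) set)" if T: "T \<subseteq> V" "card T = i" "T \<noteq> F" for T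
  proof -
    have "finite T" "finite F" using T F fin finite_subset by blast+
    have "\<not> T \<subseteq> F" using card_subset_eq[OF \<open>finite F\<close>] T F by metis
    then obtain v where v: "v \<in> T" "v \<notin> F" by blast
    have "mvar v \<in> (PF F :: (('v \<Rightarrow>\<^sub>0 nat) \<Rightarrow>\<^sub>0 'k) set)"
      using v T by (auto simp: nonface_ideal_def monom_ideal_def mem_polys_iff mvar_def)
    then have "(\<Prod>v\<in>T - {v}. mvar v) * mvar v \<in> (PF F :: (('v \<Rightarrow>\<^sub>0 nat) \<Rightarrow>\<^sub>0 'k) set)"
      using T by (intro ideal_mult[OF J] prod_mvar_in_polys) auto
    then show ?thesis
      unfolding prod.remove[OF \<open>finite T\<close> v(1)] by (simp add: mult.commute)
  qed
  then have *: "(\<Sum>T\<in>{T. T \<subseteq> V \<and> card T = i} - {F}. \<Prod>v\<in>T. mvar v) \<in> (PF F :: (('v \<Rightarrow>\<^sub>0 nat) \<Rightarrow>\<^sub>0 'k) set)"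
    by (intro ideal_sum[OF J]) auto
  have "finite {T. T \<subseteq> V \<and> card T = i}" using fin by simp
  then have "elem_sym V i - (\<Prod>v\<in>F. mvar v :: ('v \<Rightarrow>\<^sub>0 nat) \<Rightarrow>\<^sub>0 'k) = (\<Sum>T\<in>{T. T \<subseteq> V \<and> card T = i} - {F}. \<Prod>v\<in>T. mvar v)"
    using F unfolding elem_sym_def by (subst sum.remove[of _ F]) auto
  then show ?thesis using * by simp
qed

text \<open>Induction on \<open>card F\<close>. If \<open>F\<close> has \<open>t + 1\<close>
  elements, the polynomial becomes the product of the variables of \<open>F\<close>, each a
  nonzerodivisor. If \<open>F\<close> is larger, remove a variable \<open>x\<close>: the polynomial
  is a nonzerodivisor modulo \<open>x\<close> by induction, and \<open>x\<close> is one modulo the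
  earlier members. In a graded ring such a pair may be exchanged, which is the argument with powers
  of \<open>x\<close> below.\<close>

lemma elem_sym_nonzerodivisor_face:
  assumes IH: "\<And>F. F \<subseteq> V \<Longrightarrow> t \<le> card F \<Longrightarrow>
      weakly_regular (polys V) (PF F) (elem_syms V t :: (('v \<Rightarrow>\<^sub>0 nat) \<Rightarrow>\<^sub>0 'k::comm_ring_1) list)"
  assumes F: "F \<subseteq> V" "Suc t \<le> card F"
  shows "nonzerodivisor_mod (polys V) (ideal_plus (polys V) (PF F) (elem_syms V t))
           (elem_sym V (Suc t) :: ('v \<Rightarrow>\<^sub>0 nat) \<Rightarrow>\<^sub>0 'k)"
  using F
proof (induction "card F" arbitrary: F rule: less_induct)
  case less
  let ?e = "elem_sym V (Suc t) :: ('v \<Rightarrow>\<^sub>0 nat) \<Rightarrow>\<^sub>0 'k"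
  let ?Q = "\<lambda>F. ideal_plus (polys V) (PF F) (elem_syms V t) :: (('v \<Rightarrow>\<^sub>0 nat) \<Rightarrow>\<^sub>0 'k) set"
  have J: "ring_ideal (polys V) (PF F :: (('v \<Rightarrow>\<^sub>0 nat) \<Rightarrow>\<^sub>0 'k) set)" for F by (intro ring_ideal_nonface_ideal down_closed_Pow)
  have Q: "ring_ideal (polys V) (?Q F)" for F
    by (intro ideal_ideal_plus J elem_syms_in_polys)
  have e: "?e \<in> polys V" by (rule elem_sym_in_polys)
  have finF: "finite F" using less fin finite_subset by blast
  have x: "nonzerodivisor_mod (polys V) (?Q F) (mvar v)" if v: "v \<in> F" for v
    using that less.prems finF by (intro mvar_nonzerodivisor_face IH) auto
  show ?case
  proof (cases "card F = Suc t")
    case True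
    have "nonzerodivisor_mod (polys V) (?Q F) (\<Prod>v\<in>F. mvar v)"
      using finF x less.prems
      by (intro nonzerodivisor_mod_prod unital_subring_polys) (auto intro: mvar_in_polys)
    moreover have diff: "?e - (\<Prod>v\<in>F. mvar v) \<in> ?Q F"
      using elem_sym_minus_prod_in_face[OF less.prems(1) True] subset_ideal_plus[OF J elem_syms_in_polys] by blast
    have "(\<Prod>v\<in>F. mvar v) * p \<in> ?Q F" if "p \<in> polys V" "?e * p \<in> ?Q F" for p
      using ideal_diff[OF Q that(2) ideal_mult[OF Q that(1) diff]] by (simp add: algebra_simps)
    ultimately show ?thesis unfolding nonzerodivisor_mod_def by blast
  next
    case False
    then have card: "Suc t < card F" using less.prems by simp
    then have "F \<noteq> {}" by auto
    then obtain v where v: "v \<in> F" by blast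
    have vV: "v \<in> V" using v less.prems by blast
    have xv: "mvar v ^ N \<in> polys V" for N
      by (induction N) (auto simp: closed mvar_in_polys vV)
    have "nonzerodivisor_mod (polys V) (?Q (F - {v})) ?e"
      using v less.prems finF card by (intro less.hyps) (auto simp: card_gt_0_iff)
    moreover have "?Q (F - {v}) = adjoin (polys V) (?Q F) (mvar v)"
      using v less.prems by (simp only: ideal_plus_adjoin[symmetric] adjoin_face)
    ultimately have e_x: "nonzerodivisor_mod (polys V) (adjoin (polys V) (?Q F) (mvar v)) ?e" by simp
    have hom: "homogeneous_ideal V (?Q F)"
      unfolding nonface_ideal_def
      by (intro homogeneous_ideal_ideal_plus homogeneous_ideal_monom_ideal up_closed_nonfaces down_closed_Pow)
        (auto simp: elem_syms_def elem_sym_in_polys intro: homogeneous_elem_sym[OF fin])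
    show ?thesis
      unfolding nonzerodivisor_mod_def
    proof (intro ballI impI)
      fix p assume p: "p \<in> polys V" "?e * p \<in> ?Q F"
      \<comment> \<open>If \<open>p = j + x ^ N * a\<close>, cancelling \<open>x ^ N\<close> shows
        that the polynomial annihilates \<open>a\<close> modulo \<open>?Q F\<close>; hence
        \<open>a\<close> is divisible by \<open>x\<close> modulo \<open>?Q F\<close>, and the power
        of \<open>x\<close> rises by one.\<close>
      have "p \<in> adjoin (polys V) (?Q F) (mvar v ^ N)" for N
      proof (induction N)
        case 0
        have "1 * p \<in> adjoin (polys V) (?Q F) 1" using p by (intro adjoin_mult_mem[OF Q])
        then show ?case by simp
      next
        case (Suc N)
        then obtain j a where ja: "p = j + mvar v ^ N * a" "j \<in> ?Q F" "a \<in> polys V"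
          unfolding adjoin_def by blast
        have "?e * p - ?e * j \<in> ?Q F" by (rule ideal_diff[OF Q p(2) ideal_mult[OF Q e ja(2)]])
        then have "mvar v ^ N * (?e * a) \<in> ?Q F" using ja(1) by (simp add: algebra_simps)
        then have "?e * a \<in> ?Q F"
        proof (induction N)
          case (Suc N)
          have "mvar v ^ N * (?e * a) \<in> polys V" using xv e ja(3) by (intro mult_closed)
          then show ?case using Suc x[OF v] by (simp add: nonzerodivisor_mod_def mult.assoc)
        qed simp
        then have "?e * a \<in> adjoin (polys V) (?Q F) (mvar v)" using subset_adjoin[OF Q] by blast
        then have "a \<in> adjoin (polys V) (?Q F) (mvar v)"
          using e_x ja(3) unfolding nonzerodivisor_mod_def by blast
        then obtain j' b where b: "a = j' + mvar v * b" "j' \<in> ?Q F" "b \<in> polys V"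
          unfolding adjoin_def by blast
        have "p = (j + mvar v ^ N * j') + mvar v ^ Suc N * b" using ja b by (simp add: algebra_simps)
        moreover have "j + mvar v ^ N * j' \<in> ?Q F" using ja b xv by (intro ideal_add[OF Q] ideal_mult[OF Q])
        ultimately show ?case unfolding adjoin_def using b by blast
      qed
      then show "p \<in> ?Q F"
        by (rule homogeneous_ideal_separated[OF hom homogeneous_mvar[OF vV fin]])
    qed
  qed
qed

lemma weakly_regular_face:
  assumes "F \<subseteq> V" "t \<le> card F"
  shows "weakly_regular (polys V) (PF F) (elem_syms V t :: (('v \<Rightarrow>\<^sub>0 nat) \<Rightarrow>\<^sub>0 'k::comm_ring_1) list)"
  using assms
proof (induction t arbitrary: F)
  case (Suc t)
  then show ?case
    using elem_sym_nonzerodivisor_face[of t F, OF Suc.IH]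
    by (simp add: elem_syms_Suc weakly_regular_append)
qed simp

end


section \<open>Regular monomial ideals of graphs of bounded degree\<close>

text \<open>The argument \<open>K\<close> fixes the coefficient ring, which no other argument
  determines.\<close>

definition monom_regular :: "'k::comm_ring_1 itself \<Rightarrow> 'v set \<Rightarrow> nat \<Rightarrow> ('v \<Rightarrow>\<^sub>0 nat) set \<Rightarrow> bool" where
  "monom_regular K V t U \<longleftrightarrow>
     weakly_regular (polys V) (monom_ideal V U :: (('v \<Rightarrow>\<^sub>0 nat) \<Rightarrow>\<^sub>0 'k) set) (elem_syms V t)"

abbreviation face_regular :: "'k::comm_ring_1 itself \<Rightarrow> 'v set \<Rightarrow> nat \<Rightarrow> 'v set set \<Rightarrow> bool" where
  "face_regular K V t \<Delta> \<equiv> monom_regular K V t {a. Poly_Mapping.keys a \<notin> \<Delta>}"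

lemma monom_regular_cong:
  assumes "\<And>a. Poly_Mapping.keys a \<subseteq> V \<Longrightarrow> a \<in> U \<longleftrightarrow> a \<in> U'"
  shows "monom_regular K V t U \<longleftrightarrow> monom_regular K V t U'"
  unfolding monom_regular_def by (simp only: monom_ideal_cong[of V U U', OF assms])

lemma monom_regular_split:
  assumes U: "up_closed U" and b: "Poly_Mapping.keys b \<subseteq> V"
    and "monom_regular K V t {a. b + a \<in> U}" "monom_regular K V t (U \<union> range ((+) b))"
  shows "monom_regular (K :: 'k::comm_ring_1 itself) V t U"
proof -
  interpret unital_subring "polys V :: (('a \<Rightarrow>\<^sub>0 nat) \<Rightarrow>\<^sub>0 'k) set" by (rule unital_subring_polys)
  show ?thesis
    using assms(3,4)
      weakly_regular_extension[OF ring_ideal_monom_ideal[OF U] monom_in_polys[OF b] elem_syms_in_polys]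
    unfolding monom_regular_def adjoin_monom_ideal[OF U b] colon_monom_ideal[OF b] by blast
qed

lemma face_regular_split:
  assumes D: "down_closed \<Delta>" and v: "v \<in> V"
    and 1: "face_regular K V t {s. insert v s \<in> \<Delta>}" and 2: "face_regular K V t {s \<in> \<Delta>. v \<notin> s}"
  shows "face_regular K V t \<Delta>"
proof (rule monom_regular_split[where b = "Poly_Mapping.single v 1"])
  show "up_closed {a. Poly_Mapping.keys a \<notin> \<Delta>}" by (rule up_closed_nonfaces[OF D])
  show "Poly_Mapping.keys (Poly_Mapping.single v 1 :: 'a \<Rightarrow>\<^sub>0 nat) \<subseteq> V" using v by simp
  show "monom_regular K V t {a. Poly_Mapping.single v 1 + a \<in> {a. Poly_Mapping.keys a \<notin> \<Delta>}}"
    using 1 by (simp add: keys_add_nat)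
  show "monom_regular K V t ({a. Poly_Mapping.keys a \<notin> \<Delta>} \<union> range ((+) (Poly_Mapping.single v 1)))"
  proof -
    have "{a::'a \<Rightarrow>\<^sub>0 nat. Poly_Mapping.keys a \<notin> \<Delta>} \<union> {a. v \<in> Poly_Mapping.keys a}
        = {a. Poly_Mapping.keys a \<notin> {s \<in> \<Delta>. v \<notin> s}}" by auto
    then show ?thesis using 2 by (simp only: range_add_single)
  qed
qed

text \<open>Needed for colon ideals equal to the whole ring; they arise at a vertex adjacent to both
  ends of an edge.\<close>

lemma face_regular_empty: "face_regular (K :: 'k::comm_ring_1 itself) V t {}"
proof -
  interpret unital_subring "polys V :: (('a \<Rightarrow>\<^sub>0 nat) \<Rightarrow>\<^sub>0 'k) set" by (rule unital_subring_polys)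
  have "monom_ideal V {a. Poly_Mapping.keys a \<notin> {}} = (polys V :: (('a \<Rightarrow>\<^sub>0 nat) \<Rightarrow>\<^sub>0 'k) set)"
    by (simp add: monom_ideal_def)
  then show ?thesis unfolding monom_regular_def by (simp only: weakly_regular_self[OF elem_syms_in_polys])
qed

lemma face_regular_Pow:
  assumes "finite V" "F \<subseteq> V" "t \<le> card F"
  shows "face_regular K V t (Pow F)"
  unfolding monom_regular_def
  by (rule weakly_regular_face[OF assms, unfolded nonface_ideal_def])

text \<open>\<open>N v\<close> is the neighbourhood of \<open>v\<close> in the complementary graph.
  Symmetry together with \<open>N_subset\<close> makes it empty for \<open>v\<close> outside
  \<open>V\<close>, so the bounds can be stated for all \<open>v\<close>. Positivity of
  \<open>d\<close> permits cancelling \<open>2 * d\<close> when the count is evaluated.\<close>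

locale bounded_degree_graph =
  fixes V :: "'v set" and N :: "'v \<Rightarrow> 'v set" and d :: nat
  assumes finite_V: "finite V"
    and N_subset: "\<And>v. N v \<subseteq> V"
    and N_irrefl: "\<And>v. v \<notin> N v"
    and N_sym: "\<And>u v. u \<in> N v \<Longrightarrow> v \<in> N u"
    and card_N: "\<And>v. card (N v) \<le> d"
    and d_pos: "0 < d"
begin

section \<open>Independence complexes with free vertices\<close>

definition indep :: "'v set \<Rightarrow> bool" where
  "indep s \<longleftrightarrow> (\<forall>u\<in>s. s \<inter> N u = {})"

lemma finite_N: "finite (N v)"
  using N_subset finite_V finite_subset by blast

lemma indep_mono: "indep s \<Longrightarrow> r \<subseteq> s \<Longrightarrow> indep r"
  unfolding indep_def by blast

lemma indep_insert: "indep (insert x s) \<longleftrightarrow> indep s \<and> s \<inter> N x = {}"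
  unfolding indep_def using N_sym N_irrefl by blast

text \<open>For disjoint \<open>A\<close> and \<open>F\<close>, the join of the independence complex
  of the graph induced on \<open>A\<close> with the full simplex on \<open>F\<close>.\<close>

definition indep_join :: "'v set \<Rightarrow> 'v set \<Rightarrow> 'v set set" where
  "indep_join A F = {s. s \<subseteq> A \<union> F \<and> indep (s \<inter> A)}"

lemma down_closed_indep_join: "down_closed (indep_join A F)"
  unfolding down_closed_def
proof (intro ballI allI impI)
  fix s r assume s: "s \<in> indep_join A F" "r \<subseteq> s"
  have "indep (r \<inter> A)" by (rule indep_mono[of "s \<inter> A"]) (use s in \<open>auto simp: indep_join_def\<close>)
  then show "r \<in> indep_join A F" using s unfolding indep_join_def by blast
qed

lemma link_indep_join:
  assumes x: "x \<in> A" and AF: "A \<inter> F = {}"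
  shows "{s. insert x s \<in> indep_join A F} = indep_join (A - N x - {x}) (insert x F)"
proof (intro equalityI subsetI)
  fix s assume "s \<in> {s. insert x s \<in> indep_join A F}"
  then have s: "s \<subseteq> A \<union> F" "indep (insert x (s \<inter> A))"
    using x by (simp_all add: indep_join_def)
  then have "s \<inter> A \<inter> N x = {}" "indep (s \<inter> A)" by (simp_all add: indep_insert)
  moreover have "indep (s \<inter> (A - N x - {x}))" by (rule indep_mono[OF s(2)]) blast
  ultimately show "s \<in> indep_join (A - N x - {x}) (insert x F)"
    using s(1) unfolding indep_join_def by blast
next
  fix s assume "s \<in> indep_join (A - N x - {x}) (insert x F)"
  then have s: "s \<subseteq> (A - N x - {x}) \<union> insert x F" "indep (s \<inter> (A - N x - {x}))"
    by (simp_all add: indep_join_def)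
  have "insert x s \<inter> A = insert x (s \<inter> (A - N x - {x}))" using s(1) x AF by blast
  moreover have "indep (insert x (s \<inter> (A - N x - {x})))" unfolding indep_insert using s(2) by blast
  ultimately show "s \<in> {s. insert x s \<in> indep_join A F}"
    using s(1) x unfolding indep_join_def by auto
qed

lemma deletion_indep_join:
  assumes "x \<in> A" "A \<inter> F = {}"
  shows "{s \<in> indep_join A F. x \<notin> s} = indep_join (A - {x}) F"
proof -
  have "s \<in> indep_join A F \<and> x \<notin> s \<longleftrightarrow> s \<in> indep_join (A - {x}) F" for s
  proof (cases "x \<in> s")
    case True
    then show ?thesis using assms unfolding indep_join_def by blast
  next
    case False
    then have "s \<inter> (A - {x}) = s \<inter> A" "s \<subseteq> A \<union> F \<longleftrightarrow> s \<subseteq> (A - {x}) \<union> F" by blast+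
    then show ?thesis using False unfolding indep_join_def by simp
  qed
  then show ?thesis by blast
qed

text \<open>A vertex without neighbours in \<open>A\<close> is a cone point of the independence
  complex, hence already free.\<close>

lemma isolated_indep_join:
  assumes "y \<in> A" "A \<inter> F = {}" "A \<inter> N y = {}"
  shows "indep_join A F = indep_join (A - {y}) (insert y F)"
proof -
  have *: "indep (s \<inter> A) \<longleftrightarrow> indep (s \<inter> (A - {y}))" for s
  proof
    assume s: "indep (s \<inter> (A - {y}))"
    then have "indep (insert y (s \<inter> (A - {y})))" unfolding indep_insert using assms by blast
    then show "indep (s \<inter> A)" by (rule indep_mono) blast
  qed (rule indep_mono, auto)
  have "A \<union> F = (A - {y}) \<union> insert y F" using assms by blast
  then show ?thesis unfolding indep_join_def by (simp add: *)
qed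

text \<open>Deleting the neighbours of \<open>y\<close> one after the other makes \<open>y\<close> a free vertex; the set \<open>X\<close> keeps
  track of those already deleted.  Each link on the way gains a free vertex as well, and in either
  case at most \<open>2d\<close> vertices of \<open>A\<close> are spent per free vertex.\<close>

lemma face_regular_indep_join_aux:
  assumes "A \<inter> F = {}" "A \<union> F \<subseteq> V"
    and "A = {} \<and> X = {} \<or> (\<exists>y\<in>A. X \<subseteq> N y - A)"
    and "2 * d * t < card A + card X + 2 * d * (card F + 1)"
  shows "face_regular K V t (indep_join A F)"
  using assms
proof (induction "card A" arbitrary: A F X rule: less_induct)
  case less
  have fin: "finite A" "finite F" using less.prems(2) finite_V finite_subset by blast+
  \<comment> \<open>Whenever a free vertex is gained, the record \<open>X\<close> is reset to the
    empty set: the deletions it counted have been paid for.\<close>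
  have IH0: "face_regular K V t (indep_join A' F')"
    if "A' \<inter> F' = {}" "A' \<union> F' \<subseteq> V" "card A' < card A" "2 * d * t < card A' + 2 * d * (card F' + 1)" for A' F'
  proof (rule less.hyps[of A' F' "{}"])
    show "A' = {} \<and> {} = {} \<or> (\<exists>y\<in>A'. {} \<subseteq> N y - A')" by blast
  qed (use that in simp_all)
  show ?case
  proof (cases "A = {}")
    case True
    \<comment> \<open>With \<open>A\<close> exhausted there is no \<open>y\<close> left, so
      \<open>X\<close> is empty and the count bounds \<open>t\<close> by
      \<open>card F\<close>.\<close>
    then have "2 * d * t < 2 * d * (card F + 1)" using less.prems by auto
    then have "t < card F + 1" by (simp only: mult_less_cancel1)
    then have "t \<le> card F" by simp
    moreover have "indep_join A F = Pow F" using True by (auto simp: indep_join_def indep_def)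
    ultimately show ?thesis using less.prems finite_V by (simp only:) (intro face_regular_Pow, auto)
  next
    case False
    then obtain y where y: "y \<in> A" "X \<subseteq> N y - A" using less.prems by auto
    show ?thesis
    proof (cases "A \<inter> N y = {}")
      case True
      \<comment> \<open>Freeing \<open>y\<close> spends \<open>y\<close> and the credit for
        \<open>X\<close>, at most \<open>d + 1\<close> in all; this is at most \<open>2 * d\<close>
        because \<open>d\<close> is positive.\<close>
      have "X \<subseteq> N y" using y by blast
      then have "card X \<le> d" using card_mono[OF finite_N] card_N[of y] le_trans by blast
      then have "card X + 1 \<le> 2 * d" using d_pos by simp
      moreover have "card (A - {y}) + 1 = card A" using card_Suc_Diff1[OF fin(1) y(1)] by simp
      moreover have "y \<notin> F" using y less.prems(1) by blast
      then have "card (insert y F) = card F + 1" using fin by simp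
      ultimately have "2 * d * t < card (A - {y}) + 2 * d * (card (insert y F) + 1)"
        using less.prems(4) by (simp add: algebra_simps)
      moreover have "card (A - {y}) < card A" using \<open>card (A - {y}) + 1 = card A\<close> by simp
      moreover have "(A - {y}) \<inter> insert y F = {}" "(A - {y}) \<union> insert y F \<subseteq> V"
        using less.prems(1,2) y(1) by blast+
      ultimately have "face_regular K V t (indep_join (A - {y}) (insert y F))"
        by (intro IH0)
      then show ?thesis using isolated_indep_join[OF y(1) less.prems(1) True] by simp
    next
      case False
      then obtain x where x: "x \<in> A" "x \<in> N y" by blast
      show ?thesis
      proof (rule face_regular_split[OF down_closed_indep_join])
        show "x \<in> V" using x N_subset by blast
        \<comment> \<open>The tight case of the constant: \<open>x\<close> is a neighbour of
          \<open>y\<close> not yet recorded, so \<open>card X \<le> d - 1\<close>, while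
          \<open>x\<close> and its neighbours account for at most \<open>d + 1\<close> vertices.
          Together this is \<open>2 * d\<close>, the price of the free vertex
          \<open>x\<close>.\<close>
        have "X \<subseteq> N y - {x}" using y x by blast
        then have "card X \<le> card (N y - {x})" using finite_N by (intro card_mono) auto
        moreover have "card (N y - {x}) + 1 = card (N y)"
          using card_Suc_Diff1[OF finite_N x(2)] by simp
        ultimately have X: "card X + 1 \<le> d" using card_N[of y] by linarith
        have "A - N x - {x} = A - insert x (N x)" by blast
        then have "card A \<le> card (A - N x - {x}) + card (insert x (N x))"
          using diff_card_le_card_Diff[of "insert x (N x)" A] finite_N by simp
        also have "card (insert x (N x)) \<le> d + 1" using card_insert_le_m1 card_N[of x] finite_N[of x] by (simp add: card_insert_if)
        finally have "card A \<le> card (A - N x - {x}) + d + 1" by simp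
        moreover have "x \<notin> F" using x less.prems(1) by blast
        then have "card (insert x F) = card F + 1" using fin by simp
        ultimately have "2 * d * t < card (A - N x - {x}) + 2 * d * (card (insert x F) + 1)"
          using less.prems(4) X by (simp add: algebra_simps)
        moreover have "card (A - N x - {x}) < card A" using x fin by (intro psubset_card_mono) auto
        moreover have "(A - N x - {x}) \<inter> insert x F = {}" "(A - N x - {x}) \<union> insert x F \<subseteq> V"
          using less.prems(1,2) x(1) by blast+
        ultimately have "face_regular K V t (indep_join (A - N x - {x}) (insert x F))"
          by (intro IH0)
        then show "face_regular K V t {s. insert x s \<in> indep_join A F}"
          unfolding link_indep_join[OF x(1) less.prems(1)] .
        have fX: "finite X" using y finite_N finite_subset by blast
        have "x \<notin> X" using x y by blast
        have "card A = card (A - {x}) + 1" using card_Suc_Diff1[OF fin(1) x(1)] by simp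
        \<comment> \<open>Moving \<open>x\<close> from \<open>A\<close> to \<open>X\<close> leaves
          the count unchanged, so deletions cost nothing until the next free vertex is
          gained.\<close>
        then have "2 * d * t < card (A - {x}) + card (insert x X) + 2 * d * (card F + 1)"
          using less.prems(4) \<open>x \<notin> X\<close> fX by simp
        moreover have "y \<in> A - {x}" "insert x X \<subseteq> N y - (A - {x})" using x y N_irrefl by auto
        then have "\<exists>y\<in>A - {x}. insert x X \<subseteq> N y - (A - {x})" by blast
        moreover have "card (A - {x}) < card A" using \<open>card A = card (A - {x}) + 1\<close> by simp
        moreover have "(A - {x}) \<inter> F = {}" "(A - {x}) \<union> F \<subseteq> V" using less.prems(1,2) by blast+
        ultimately have "face_regular K V t (indep_join (A - {x}) F)"
          using less.hyps[of "A - {x}" F "insert x X"] by blast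
        then show "face_regular K V t {s \<in> indep_join A F. x \<notin> s}"
          unfolding deletion_indep_join[OF x(1) less.prems(1)] .
      qed
    qed
  qed
qed

lemma face_regular_indep_join:
  assumes "A \<inter> F = {}" "A \<union> F \<subseteq> V" "2 * d * t < card A + 2 * d * (card F + 1)"
  shows "face_regular K V t (indep_join A F)"
  using assms by (intro face_regular_indep_join_aux[where X = "{}"]) auto

text \<open>The complex of the colon ideal by \<open>x\<^sub>v x\<^sub>w\<close>, where \<open>D\<close> consists of the vertices that an edge
  adjoined earlier joins to \<open>v\<close> or \<open>w\<close>.\<close>

definition edge_link :: "'v \<Rightarrow> 'v \<Rightarrow> 'v set \<Rightarrow> 'v set set" where
  "edge_link v w D = {s. s \<subseteq> V - D \<and> indep s \<and> (s \<inter> N v = {} \<or> s \<inter> N w = {})}"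

lemma edge_link_commute: "edge_link v w D = edge_link w v D"
  unfolding edge_link_def by blast

lemma down_closed_edge_link: "down_closed (edge_link v w D)"
  unfolding down_closed_def
proof (intro ballI allI impI)
  fix s r assume s: "s \<in> edge_link v w D" "r \<subseteq> s"
  have "indep r" by (rule indep_mono[of s]) (use s in \<open>auto simp: edge_link_def\<close>)
  then show "r \<in> edge_link v w D" using s unfolding edge_link_def by blast
qed

lemma card_N_Un: "card (N v \<union> N w) \<le> 2 * d"
  using card_Un_le[of "N v" "N w"] card_N[of v] card_N[of w] by simp

text \<open>A face containing \<open>z\<close> meets \<open>N w\<close>, so it has to avoid
  \<open>N v\<close>; therefore \<open>v\<close> is free along with \<open>z\<close>. At most
  \<open>3 * d\<close> vertices are lost, while two free vertices are worth
  \<open>4 * d\<close>.\<close>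

lemma face_regular_edge_link_vertex:
  assumes vw: "w \<in> N v" and D: "D \<subseteq> N v \<union> N w - {v, w}"
    and z: "z \<in> N w" "z \<notin> N v" "z \<noteq> v" "z \<notin> D" and t: "2 * d * t < card V + 2 * d"
  shows "face_regular K V t {s. insert z s \<in> edge_link v w D}"
proof -
  let ?B = "N v \<union> N w \<union> N z"
  let ?A = "V - D - N v - N z - {v, z}"
  have V: "v \<in> V" "w \<in> V" "z \<in> V" using vw z N_sym N_subset by blast+
  have vNz: "v \<notin> N z" "w \<in> N z" "v \<in> N w" using z N_sym vw by blast+
  have "V - ?B \<subseteq> ?A" using D vNz z by blast
  then have "card (V - ?B) \<le> card ?A" using finite_V by (intro card_mono) auto
  moreover have "card V - card ?B \<le> card (V - ?B)"
    by (rule diff_card_le_card_Diff) (simp add: finite_N)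
  moreover have "card ?B \<le> 2 * d + d"
    using card_Un_le[of "N v \<union> N w" "N z"] card_N_Un[of v w] card_N[of z] by simp
  moreover have "card {v, z} = 2" using z by auto
  ultimately have "2 * d * t < card ?A + 2 * d * (card {v, z} + 1)" using t by simp
  then have "face_regular K V t (indep_join ?A {v, z})"
    using V by (intro face_regular_indep_join) auto
  moreover have "insert z s \<in> edge_link v w D \<longleftrightarrow> s \<in> indep_join ?A {v, z}" for s
  proof
    assume "insert z s \<in> edge_link v w D"
    then have s: "s \<subseteq> V - D" "indep s" "s \<inter> N z = {}" "s \<inter> N v = {}"
      using z unfolding edge_link_def by (auto simp: indep_insert)
    have "indep (s \<inter> ?A)" by (rule indep_mono[OF s(2)]) blast
    then show "s \<in> indep_join ?A {v, z}" unfolding indep_join_def using s by blast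
  next
    assume s: "s \<in> indep_join ?A {v, z}"
    have "indep (insert v (insert z (s \<inter> ?A)))"
      using s z vNz unfolding indep_join_def by (simp add: indep_insert) blast
    then have "indep (insert z s)"
      by (rule indep_mono) (use s in \<open>auto simp: indep_join_def\<close>)
    then show "insert z s \<in> edge_link v w D"
      using s z V D N_irrefl unfolding indep_join_def edge_link_def by auto
  qed
  ultimately show ?thesis by simp
qed

text \<open>The neighbours of \<open>v\<close> and \<open>w\<close> are deleted one by one, which
  only enlarges \<open>D\<close>. At such a vertex \<open>z\<close> the star has no faces if
  \<open>z\<close> is adjacent to both ends, since both alternatives in \<open>edge_link\<close>
  fail, and otherwise the preceding lemma applies. After all deletions a face contains at most one
  of \<open>v\<close> and \<open>w\<close>; splitting at \<open>v\<close> leaves one free endpoint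
  on either side.\<close>

lemma face_regular_edge_link:
  assumes vw: "w \<in> N v" and D: "D \<subseteq> N v \<union> N w - {v, w}" and t: "2 * d * t < card V + 2 * d"
  shows "face_regular K V t (edge_link v w D)"
  using D
proof (induction "card (N v \<union> N w - {v, w} - D)" arbitrary: D rule: less_induct)
  case less
  let ?R = "N v \<union> N w - {v, w}"
  have wv: "v \<in> N w" using vw by (rule N_sym)
  have neq: "v \<noteq> w" using vw N_irrefl by blast
  have V: "v \<in> V" "w \<in> V" using vw wv N_subset by blast+
  show ?case
  proof (cases "?R \<subseteq> D")
    case True
    then have D: "D = ?R" using less.prems by blast
    let ?A = "V - (N v \<union> N w)"
    have "card V - card (N v \<union> N w) \<le> card ?A"
      by (rule diff_card_le_card_Diff) (simp add: finite_N)
    \<comment> \<open>At most \<open>2 * d\<close> vertices are lost and one free vertex is gained,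
      so the count is exactly balanced; \<open>4 * d\<close> is
      \<open>2 * d * (card {x} + 1)\<close>.\<close>
    then have A: "2 * d * t < card ?A + 4 * d" using t card_N_Un[of v w] by simp
    have free: "face_regular K V t (indep_join ?A {x})" if "x = v \<or> x = w" for x
    proof (rule face_regular_indep_join)
      show "?A \<inter> {x} = {}" "?A \<union> {x} \<subseteq> V" using that vw wv V by blast+
      show "2 * d * t < card ?A + 2 * d * (card {x} + 1)" using A by simp
    qed
    show ?thesis
    proof (rule face_regular_split[OF down_closed_edge_link V(1)])
      have vD: "v \<notin> D" "w \<notin> D" using D by simp_all
      have free_iff: "s \<in> indep_join ?A {x} \<longleftrightarrow> s \<subseteq> ?A \<union> {x} \<and> indep s" if "x = v \<or> x = w" for s x
      proof
        assume s: "s \<in> indep_join ?A {x}"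
        then have "s \<inter> ?A \<inter> N x = {}" "indep (s \<inter> ?A)" using that unfolding indep_join_def by blast+
        then have "indep (insert x (s \<inter> ?A))" by (simp add: indep_insert)
        moreover have "s \<subseteq> ?A \<union> {x}" using s by (simp add: indep_join_def)
        then have "s \<subseteq> insert x (s \<inter> ?A)" by blast
        ultimately show "s \<subseteq> ?A \<union> {x} \<and> indep s"
          using \<open>s \<subseteq> ?A \<union> {x}\<close> indep_mono by blast
      next
        assume s: "s \<subseteq> ?A \<union> {x} \<and> indep s"
        have "indep (s \<inter> ?A)" by (rule indep_mono[of s]) (use s in blast)+
        then show "s \<in> indep_join ?A {x}" using s by (simp add: indep_join_def)
      qed
      have sub: "V - D = ?A \<union> {v, w}" using D V vw wv by blast
      have "insert v s \<in> edge_link v w D \<longleftrightarrow> s \<in> indep_join ?A {v}" for s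
      proof
        assume l: "insert v s \<in> edge_link v w D"
        then have "indep s" "s \<inter> N v = {}" by (simp_all add: edge_link_def indep_insert)
        moreover have "s \<subseteq> ?A \<union> {v, w}" using l by (simp add: edge_link_def sub)
        ultimately have "s \<subseteq> ?A \<union> {v}" using vw by blast
        then show "s \<in> indep_join ?A {v}" using free_iff \<open>indep s\<close> by blast
      next
        assume "s \<in> indep_join ?A {v}"
        then have s: "s \<subseteq> ?A \<union> {v}" "indep s" using free_iff by blast+
        have "s \<inter> N v = {}" "v \<notin> N v" using s(1) N_irrefl by blast+
        moreover have "insert v s \<subseteq> V - D" unfolding sub using s(1) by blast
        ultimately show "insert v s \<in> edge_link v w D"
          using s(2) by (simp add: edge_link_def indep_insert)
      qed
      then show "face_regular K V t {s. insert v s \<in> edge_link v w D}" using free[of v] by simp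
      \<comment> \<open>Among the remaining vertices \<open>v\<close> is the only neighbour of
        \<open>w\<close>, so faces without \<open>v\<close> satisfy the second alternative
        automatically.\<close>
      have "s \<in> edge_link v w D \<and> v \<notin> s \<longleftrightarrow> s \<in> indep_join ?A {w}" for s
      proof
        assume l: "s \<in> edge_link v w D \<and> v \<notin> s"
        then have "s \<subseteq> ?A \<union> {v, w}" "indep s" by (simp_all add: edge_link_def sub)
        moreover have "s \<subseteq> ?A \<union> {w}" using \<open>s \<subseteq> ?A \<union> {v, w}\<close> l by blast
        ultimately show "s \<in> indep_join ?A {w}" using free_iff by blast
      next
        assume "s \<in> indep_join ?A {w}"
        then have s: "s \<subseteq> ?A \<union> {w}" "indep s" using free_iff by blast+
        have "s \<inter> N w = {}" using s(1) N_irrefl[of w] by blast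
        moreover have "s \<subseteq> V - D" unfolding sub using s(1) by blast
        moreover have "v \<notin> s" using s(1) wv neq by blast
        ultimately show "s \<in> edge_link v w D \<and> v \<notin> s"
          using s(2) by (simp add: edge_link_def)
      qed
      then show "face_regular K V t {s \<in> edge_link v w D. v \<notin> s}" using free[of w] by simp
    qed
  next
    case False
    then obtain z where z: "z \<in> N v \<union> N w" "z \<noteq> v" "z \<noteq> w" "z \<notin> D" by blast
    show ?thesis
    proof (rule face_regular_split[OF down_closed_edge_link])
      show "z \<in> V" using z N_subset by blast
      show "face_regular K V t {s. insert z s \<in> edge_link v w D}"
      proof (cases "z \<in> N v \<and> z \<in> N w")
        case True
        then have "{s. insert z s \<in> edge_link v w D} = {}" unfolding edge_link_def by blast
        then show ?thesis using face_regular_empty[of K V t] by simp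
      next
        case False
        then consider "z \<in> N w" "z \<notin> N v" | "z \<in> N v" "z \<notin> N w" using z by blast
        then show ?thesis
        proof cases
          case 1
          show ?thesis
            by (rule face_regular_edge_link_vertex[OF vw less.prems]) (use 1 z t in simp_all)
        next
          case 2
          have D: "D \<subseteq> N w \<union> N v - {w, v}" using less.prems by blast
          have "face_regular K V t {s. insert z s \<in> edge_link w v D}"
            by (rule face_regular_edge_link_vertex[OF wv D]) (use 2 z t in simp_all)
          then show ?thesis using edge_link_commute[of v w D] by simp
        qed
      qed
      have "face_regular K V t (edge_link v w (insert z D))"
      proof (rule less.hyps)
        show "card (?R - insert z D) < card (?R - D)"
        proof (rule psubset_card_mono)
          show "finite (?R - D)" using finite_N by blast
          show "?R - insert z D \<subset> ?R - D" using z by blast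
        qed
        show "insert z D \<subseteq> ?R" using less.prems z by blast
      qed
      moreover have "{s \<in> edge_link v w D. z \<notin> s} = edge_link v w (insert z D)"
        unfolding edge_link_def by blast
      ultimately show "face_regular K V t {s \<in> edge_link v w D. z \<notin> s}" by simp
    qed
  qed
qed

end


section \<open>The second symbolic power as a monomial ideal\<close>

lemma range_add_two_singles:
  assumes "v \<noteq> w"
  shows "range ((+) (Poly_Mapping.single v 1 + Poly_Mapping.single w 1))
      = {a::'v \<Rightarrow>\<^sub>0 nat. v \<in> Poly_Mapping.keys a \<and> w \<in> Poly_Mapping.keys a}"
proof (intro equalityI subsetI)
  fix a :: "'v \<Rightarrow>\<^sub>0 nat" assume "a \<in> {a. v \<in> Poly_Mapping.keys a \<and> w \<in> Poly_Mapping.keys a}"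
  then have "a = (Poly_Mapping.single v 1 + Poly_Mapping.single w 1)
      + (a - (Poly_Mapping.single v 1 + Poly_Mapping.single w 1))"
    using assms by (intro poly_mapping_eqI) (auto simp: lookup_add lookup_minus lookup_single when_def in_keys_iff)
  then show "a \<in> range ((+) (Poly_Mapping.single v 1 + Poly_Mapping.single w 1))" by blast
qed (auto simp: keys_add_nat)

lemma weight_single: "finite W \<Longrightarrow> weight W (Poly_Mapping.single v 1) = (if v \<in> W then 1 else 0)"
  by (simp add: weight_def lookup_single when_def)

lemma weight_eq_0_iff: "finite W \<Longrightarrow> weight W a = 0 \<longleftrightarrow> Poly_Mapping.keys a \<inter> W = {}"
  by (auto simp: weight_def in_keys_iff)

context bounded_degree_graph
begin

text \<open>The sets \<open>V - F\<close> are the vertex covers, and weight at least 2 describes the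
  square of the prime generated by such a cover. Letting \<open>F\<close> run over all independent
  sets instead of the maximal ones changes nothing, since a smaller \<open>F\<close> only increases
  the weight.\<close>

definition symbolic_exponents :: "('v \<Rightarrow>\<^sub>0 nat) set" where
  "symbolic_exponents = {a. \<forall>F \<subseteq> V. indep F \<longrightarrow> 2 \<le> weight (V - F) a}"

definition edge_exponents :: "('v \<times> 'v) set \<Rightarrow> ('v \<Rightarrow>\<^sub>0 nat) set" where
  "edge_exponents E = {a. \<exists>(v, w) \<in> E. v \<in> Poly_Mapping.keys a \<and> w \<in> Poly_Mapping.keys a}"

lemma edge_exponents_iff:
  "a \<in> edge_exponents E \<longleftrightarrow> (\<exists>v w. (v, w) \<in> E \<and> v \<in> Poly_Mapping.keys a \<and> w \<in> Poly_Mapping.keys a)"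
  by (auto simp: edge_exponents_def)

lemma up_closed_symbolic_exponents: "up_closed symbolic_exponents"
  unfolding up_closed_def symbolic_exponents_def by (auto simp: weight_add intro: trans_le_add1)

lemma up_closed_edge_exponents: "up_closed (edge_exponents E)"
  unfolding up_closed_def edge_exponents_def by (auto simp: keys_add_nat)

lemma not_indep_iff: "\<not> indep s \<longleftrightarrow> (\<exists>v w. w \<in> N v \<and> v \<in> s \<and> w \<in> s)"
  unfolding indep_def by blast

text \<open>This is why the colon ideals are squarefree. An independent set \<open>F\<close> cannot
  contain both ends of the edge, so the edge monomial alone has weight at least 1 outside
  \<open>F\<close>. Total weight below 2 then forces one end into \<open>F\<close> and leaves no
  room for \<open>a\<close> outside \<open>F\<close>: only the support of \<open>a\<close>
  counts.\<close>

lemma symbolic_exponents_add_edge_iff: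
  assumes vw: "w \<in> N v" and a: "Poly_Mapping.keys a \<subseteq> V"
  shows "Poly_Mapping.single v 1 + Poly_Mapping.single w 1 + a \<notin> symbolic_exponents \<longleftrightarrow>
    indep (Poly_Mapping.keys a) \<and> (Poly_Mapping.keys a \<inter> N v = {} \<or> Poly_Mapping.keys a \<inter> N w = {})"
    (is "?b \<notin> _ \<longleftrightarrow> ?rhs")
proof -
  have wv: "v \<in> N w" using vw by (rule N_sym)
  have V: "v \<in> V" "w \<in> V" using vw wv N_subset by blast+
  have wt: "weight (V - F) ?b = (if v \<in> F then 0 else 1) + (if w \<in> F then 0 else 1) + weight (V - F) a" for F
    using V finite_V by (simp add: weight_add weight_single[unfolded One_nat_def])
  have neq: "v \<noteq> w" using vw N_irrefl by blast
  show ?thesis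
  proof
    assume "?b \<notin> symbolic_exponents"
    then obtain F where F: "F \<subseteq> V" "indep F" "weight (V - F) ?b < 2"
      unfolding symbolic_exponents_def by (auto simp: not_le)
    have "\<not> (v \<in> F \<and> w \<in> F)" using F(2) vw unfolding indep_def by blast
    then have one: "v \<in> F \<or> w \<in> F" and "weight (V - F) a = 0"
      using F(3) unfolding wt by (auto split: if_splits)
    then have "Poly_Mapping.keys a \<inter> (V - F) = {}" using finite_V by (simp add: weight_eq_0_iff)
    then have sub: "Poly_Mapping.keys a \<subseteq> F" using a by blast
    then have "indep (Poly_Mapping.keys a)" using F(2) indep_mono by blast
    moreover have "Poly_Mapping.keys a \<inter> N v = {} \<or> Poly_Mapping.keys a \<inter> N w = {}"
      using one sub F(2) unfolding indep_def by blast
    ultimately show ?rhs by blast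
  next
    assume r: ?rhs
    have *: "?b \<notin> symbolic_exponents"
      if x: "x = v \<and> y = w \<or> x = w \<and> y = v" and xa: "Poly_Mapping.keys a \<inter> N x = {}" for x y
    proof -
      \<comment> \<open>The smallest independent set that contains the support of \<open>a\<close>
        and an endpoint \<open>x\<close> of the edge; the other endpoint \<open>y\<close>
        contributes the only weight outside it.\<close>
      let ?F = "insert x (Poly_Mapping.keys a)"
      have "indep ?F" using r xa by (simp add: indep_insert)
      moreover have "?F \<subseteq> V" using a x V by blast
      moreover have "weight (V - ?F) a = 0" using finite_V by (subst weight_eq_0_iff) auto
      then have "\<not> 2 \<le> weight (V - ?F) ?b" using x unfolding wt by auto
      ultimately show ?thesis unfolding symbolic_exponents_def by blast
    qed
    show "?b \<notin> symbolic_exponents" using r *[of v w] *[of w v] by blast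
  qed
qed

text \<open>Induction on the number of ordered edges still missing from \<open>E\<close>. Adjoining
  a missing edge is covered by the induction hypothesis, and the colon by it is the ideal of an
  \<open>edge_link\<close>.\<close>

lemma monom_regular_symbolic_edge:
  assumes E: "E \<subseteq> {(v, w). w \<in> N v}" and t: "2 * d * t < card V + 2 * d"
  shows "monom_regular K V t (symbolic_exponents \<union> edge_exponents E)"
  using E
proof (induction "card ({(v, w). w \<in> N v} - E)" arbitrary: E rule: less_induct)
  case less
  let ?All = "{(v, w). w \<in> N v}"
  have "?All \<subseteq> V \<times> V" using N_sym N_subset by blast
  then have finAll: "finite ?All" using finite_V finite_subset by blast
  show ?case
  proof (cases "?All \<subseteq> E")
    case True
    then have E: "E = ?All" using less.prems by blast
    have "face_regular K V t (indep_join V {})"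
      using t by (intro face_regular_indep_join) auto
    moreover have "a \<in> symbolic_exponents \<union> edge_exponents E \<longleftrightarrow> Poly_Mapping.keys a \<notin> indep_join V {}"
      if a: "Poly_Mapping.keys a \<subseteq> V" for a
    proof -
      have "Poly_Mapping.keys a \<inter> V = Poly_Mapping.keys a" using a by blast
      then have 1: "Poly_Mapping.keys a \<in> indep_join V {} \<longleftrightarrow> indep (Poly_Mapping.keys a)"
        using a by (simp add: indep_join_def)
      have 2: "a \<in> edge_exponents E \<longleftrightarrow> \<not> indep (Poly_Mapping.keys a)"
        unfolding edge_exponents_iff E not_indep_iff by blast
      \<comment> \<open>The second symbolic power lies in the edge ideal: if the support of
        \<open>a\<close> is independent, it serves as \<open>F\<close> and the weight outside it is
        0.\<close>
      have "a \<notin> symbolic_exponents" if "indep (Poly_Mapping.keys a)"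
      proof -
        have "weight (V - Poly_Mapping.keys a) a = 0" using finite_V by (subst weight_eq_0_iff) auto
        then have "\<not> 2 \<le> weight (V - Poly_Mapping.keys a) a" by simp
        then show ?thesis using that a unfolding symbolic_exponents_def by blast
      qed
      then show ?thesis using 1 2 by blast
    qed
    ultimately show ?thesis
      using monom_regular_cong[of V "symbolic_exponents \<union> edge_exponents E" "{a. Poly_Mapping.keys a \<notin> indep_join V {}}" K t]
      by simp
  next
    case False
    then obtain v w where vw: "w \<in> N v" "(v, w) \<notin> E" by blast
    have wv: "v \<in> N w" by (rule N_sym[OF vw(1)])
    have V: "v \<in> V" "w \<in> V" using vw wv N_subset by blast+
    have neq: "v \<noteq> w" using vw N_irrefl by blast
    let ?E = "insert (v, w) E"
    have IH: "monom_regular K V t (symbolic_exponents \<union> edge_exponents ?E)"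
    proof (rule less.hyps)
      show "card (?All - ?E) < card (?All - E)"
      proof (rule psubset_card_mono)
        show "finite (?All - E)" using finAll by blast
        show "?All - ?E \<subset> ?All - E" using vw by blast
      qed
      show "?E \<subseteq> ?All" using less.prems vw by blast
    qed
    show ?thesis
    proof (cases "(w, v) \<in> E")
      case True
      \<comment> \<open>Edges are listed as ordered pairs, and this one was adjoined before in the
        opposite orientation.\<close>
      then have "edge_exponents ?E = edge_exponents E" unfolding edge_exponents_def by blast
      then show ?thesis using IH by simp
    next
      case False
      define D where "D = {x. (x, v) \<in> E \<or> (v, x) \<in> E \<or> (x, w) \<in> E \<or> (w, x) \<in> E}"
      let ?b = "Poly_Mapping.single v 1 + Poly_Mapping.single w 1 :: 'v \<Rightarrow>\<^sub>0 nat"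
      have EN: "y \<in> N x \<and> x \<in> N y" if "(x, y) \<in> E" for x y
        using that less.prems N_sym by blast
      have "v \<notin> D" "w \<notin> D" using vw False EN N_irrefl unfolding D_def by blast+
      then have D: "D \<subseteq> N v \<union> N w - {v, w}" unfolding D_def using EN by blast
      show ?thesis
      proof (rule monom_regular_split[where b = ?b])
        show "up_closed (symbolic_exponents \<union> edge_exponents E)"
          using up_closed_symbolic_exponents up_closed_edge_exponents[of E] unfolding up_closed_def by blast
        show "Poly_Mapping.keys ?b \<subseteq> V" using V by (simp add: keys_add_nat)
        have "?b + a \<in> symbolic_exponents \<union> edge_exponents E \<longleftrightarrow> Poly_Mapping.keys a \<notin> edge_link v w D"
          if a: "Poly_Mapping.keys a \<subseteq> V" for a
        proof -
          have k: "Poly_Mapping.keys (?b + a) = insert v (insert w (Poly_Mapping.keys a))"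
            by (auto simp: keys_add_nat)
          \<comment> \<open>An earlier edge dividing the product lies neither inside the independent
            support of \<open>a\<close> nor on \<open>{v, w}\<close>, so it joins a vertex of the
            support to \<open>v\<close> or \<open>w\<close>. For dependent supports the symbolic
            part already decides the membership.\<close>
          have e: "?b + a \<in> edge_exponents E \<longleftrightarrow> Poly_Mapping.keys a \<inter> D \<noteq> {}"
            if "indep (Poly_Mapping.keys a)"
          proof
            assume "?b + a \<in> edge_exponents E"
            then obtain x y where xy: "(x, y) \<in> E" "x \<in> insert v (insert w (Poly_Mapping.keys a))"
              "y \<in> insert v (insert w (Poly_Mapping.keys a))"
              unfolding edge_exponents_iff k by blast
            have "\<not> (x \<in> Poly_Mapping.keys a \<and> y \<in> Poly_Mapping.keys a)"
              using that EN[OF xy(1)] unfolding indep_def by blast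
            moreover have "\<not> (x \<in> {v, w} \<and> y \<in> {v, w})"
              using xy(1) vw(2) False EN[OF xy(1)] N_irrefl by blast
            ultimately show "Poly_Mapping.keys a \<inter> D \<noteq> {}" using xy unfolding D_def by blast
          next
            assume "Poly_Mapping.keys a \<inter> D \<noteq> {}"
            then show "?b + a \<in> edge_exponents E" unfolding edge_exponents_iff k D_def by blast
          qed
          show ?thesis
            using symbolic_exponents_add_edge_iff[OF vw(1) a] e a unfolding edge_link_def by blast
        qed
        then show "monom_regular K V t {a. ?b + a \<in> symbolic_exponents \<union> edge_exponents E}"
          using monom_regular_cong[of V "{a. ?b + a \<in> symbolic_exponents \<union> edge_exponents E}"
              "{a. Poly_Mapping.keys a \<notin> edge_link v w D}" K t]
            face_regular_edge_link[OF vw(1) D t, of K] by blast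
        have "edge_exponents E \<union> range ((+) ?b) = edge_exponents ?E"
          unfolding range_add_two_singles[OF neq] edge_exponents_def by blast
        then show "monom_regular K V t (symbolic_exponents \<union> edge_exponents E \<union> range ((+) ?b))"
          using IH by (simp only: Un_assoc)
      qed
    qed
  qed
qed

lemma monom_regular_symbolic_exponents:
  assumes "2 * d * t < card V + 2 * d"
  shows "monom_regular K V t symbolic_exponents"
  using monom_regular_symbolic_edge[of "{}", OF _ assms] by (simp add: edge_exponents_def)

end


section \<open>Monomial prime ideals\<close>

text \<open>The lexicographically largest elements of \<open>A\<close> and \<open>B\<close> form
  such a pair. The variables carry no order, so the pair is reached by successive refinement over
  the finitely many variables involved.\<close>

lemma unique_product:
  fixes A B :: "('v \<Rightarrow>\<^sub>0 nat) set"
  assumes fin: "finite A" "finite B" and ne: "A \<noteq> {}" "B \<noteq> {}"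
  shows "\<exists>a\<in>A. \<exists>b\<in>B. \<forall>a'\<in>A. \<forall>b'\<in>B. a' + b' = a + b \<longrightarrow> a' = a \<and> b' = b"
proof -
  define W where "W = (\<Union>a\<in>A \<union> B. Poly_Mapping.keys a)"
  have "finite W" using fin by (simp add: W_def)
  text \<open>Refine \<open>A\<close> and \<open>B\<close> variable by variable to the elements of maximal exponent.\<close>
  have "\<exists>A' B'. A' \<subseteq> A \<and> B' \<subseteq> B \<and> A' \<noteq> {} \<and> B' \<noteq> {} \<and>
      (\<forall>v\<in>U. \<forall>a\<in>A'. \<forall>b\<in>A'. Poly_Mapping.lookup a v = Poly_Mapping.lookup b v) \<and>
      (\<forall>v\<in>U. \<forall>a\<in>B'. \<forall>b\<in>B'. Poly_Mapping.lookup a v = Poly_Mapping.lookup b v) \<and>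
      (\<forall>a\<in>A'. \<forall>b\<in>B'. \<forall>a'\<in>A. \<forall>b'\<in>B. a' + b' = a + b \<longrightarrow> a' \<in> A' \<and> b' \<in> B')"
    if "finite U" for U
    using that
  proof (induction U rule: finite_induct)
    case empty
    show ?case by (rule exI[of _ A], rule exI[of _ B]) (use ne in simp)
  next
    case (insert v U)
    then obtain A' B' where AB: "A' \<subseteq> A" "B' \<subseteq> B" "A' \<noteq> {}" "B' \<noteq> {}"
      and Aeq: "\<forall>v\<in>U. \<forall>a\<in>A'. \<forall>b\<in>A'. Poly_Mapping.lookup a v = Poly_Mapping.lookup b v"
      and Beq: "\<forall>v\<in>U. \<forall>a\<in>B'. \<forall>b\<in>B'. Poly_Mapping.lookup a v = Poly_Mapping.lookup b v"
      and u: "\<forall>a\<in>A'. \<forall>b\<in>B'. \<forall>a'\<in>A. \<forall>b'\<in>B. a' + b' = a + b \<longrightarrow> a' \<in> A' \<and> b' \<in> B'"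
      by blast
    define l where "l a = Poly_Mapping.lookup a v" for a :: "'v \<Rightarrow>\<^sub>0 nat"
    have fin': "finite (l ` A')" "finite (l ` B')" using AB fin finite_subset by blast+
    have max: "l a \<le> Max (l ` A')" if "a \<in> A'" for a using that fin' by simp
    have max': "l a \<le> Max (l ` B')" if "a \<in> B'" for a using that fin' by simp
    define A'' where "A'' = {a\<in>A'. l a = Max (l ` A')}"
    define B'' where "B'' = {a\<in>B'. l a = Max (l ` B')}"
    have "Max (l ` A') \<in> l ` A'" "Max (l ` B') \<in> l ` B'" using fin' AB by simp_all
    then have ne': "A'' \<noteq> {}" "B'' \<noteq> {}" unfolding A''_def B''_def by force+
    have "a' \<in> A'' \<and> b' \<in> B''"
      if ab: "a \<in> A''" "b \<in> B''" "a' \<in> A" "b' \<in> B" "a' + b' = a + b" for a b a' b'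
    proof -
      have "a \<in> A'" "b \<in> B'" using ab unfolding A''_def B''_def by simp_all
      then have m: "a' \<in> A'" "b' \<in> B'" using u ab(3-5) by blast+
      have "l a' + l b' = l a + l b" using ab(5) unfolding l_def lookup_add[symmetric] by simp
      then have "l a' + l b' = Max (l ` A') + Max (l ` B')" using ab(1,2) unfolding A''_def B''_def by simp
      then have "l a' = Max (l ` A')" "l b' = Max (l ` B')" using max[OF m(1)] max'[OF m(2)] by linarith+
      then show ?thesis using m unfolding A''_def B''_def by simp
    qed
    then have u'': "\<forall>a\<in>A''. \<forall>b\<in>B''. \<forall>a'\<in>A. \<forall>b'\<in>B. a' + b' = a + b \<longrightarrow> a' \<in> A'' \<and> b' \<in> B''"
      by blast
    have A': "\<forall>v\<in>insert v U. \<forall>a\<in>A''. \<forall>b\<in>A''. Poly_Mapping.lookup a v = Poly_Mapping.lookup b v"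
      using Aeq unfolding A''_def l_def by simp
    have B': "\<forall>v\<in>insert v U. \<forall>a\<in>B''. \<forall>b\<in>B''. Poly_Mapping.lookup a v = Poly_Mapping.lookup b v"
      using Beq unfolding B''_def l_def by simp
    have "A'' \<subseteq> A" "B'' \<subseteq> B" using AB unfolding A''_def B''_def by blast+
    then show ?case
      using ne' A' B' u'' by (intro exI[of _ A''] exI[of _ B''] conjI)
  qed
  from this[OF \<open>finite W\<close>] obtain A' B' where AB: "A' \<subseteq> A" "B' \<subseteq> B" "A' \<noteq> {}" "B' \<noteq> {}"
    and Aeq: "\<forall>v\<in>W. \<forall>a\<in>A'. \<forall>b\<in>A'. Poly_Mapping.lookup a v = Poly_Mapping.lookup b v"
    and Beq: "\<forall>v\<in>W. \<forall>a\<in>B'. \<forall>b\<in>B'. Poly_Mapping.lookup a v = Poly_Mapping.lookup b v"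
    and u: "\<forall>a\<in>A'. \<forall>b\<in>B'. \<forall>a'\<in>A. \<forall>b'\<in>B. a' + b' = a + b \<longrightarrow> a' \<in> A' \<and> b' \<in> B'"
    by blast
  obtain a b where ab: "a \<in> A'" "b \<in> B'" using AB by blast
  have eq: "x = y" if xy: "x \<in> A \<union> B" "y \<in> A \<union> B" "\<forall>v\<in>W. Poly_Mapping.lookup x v = Poly_Mapping.lookup y v" for x y
  proof (rule poly_mapping_eqI)
    fix v
    show "Poly_Mapping.lookup x v = Poly_Mapping.lookup y v"
    proof (cases "v \<in> W")
      case False
      then have "v \<notin> Poly_Mapping.keys x" "v \<notin> Poly_Mapping.keys y" using xy unfolding W_def by blast+
      then show ?thesis by (simp add: in_keys_iff)
    qed (use xy(3) in blast)
  qed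
  have "a' = a \<and> b' = b" if ab': "a' \<in> A" "b' \<in> B" "a' + b' = a + b" for a' b'
  proof -
    have "a' \<in> A'" "b' \<in> B'" using u ab ab' by blast+
    then show ?thesis using eq[of a' a] eq[of b' b] ab ab' AB Aeq Beq by blast
  qed
  then show ?thesis using ab AB by blast
qed

text \<open>The ideal generated by the variables in \<open>V \<inter> C\<close>; as a
  Stanley-Reisner ideal it belongs to the face \<open>V - C\<close>, not to
  \<open>C\<close>.\<close>

definition face_prime :: "'v set \<Rightarrow> 'v set \<Rightarrow> (('v \<Rightarrow>\<^sub>0 nat) \<Rightarrow>\<^sub>0 'k::comm_ring_1) set" where
  "face_prime V C = monom_ideal V {a. Poly_Mapping.keys a \<inter> C \<noteq> {}}"

lemma mpoly_ring_simps:
  "carrier (mpoly_ring V) = polys V" "x \<oplus>\<^bsub>mpoly_ring V\<^esub> y = x + y" "x \<otimes>\<^bsub>mpoly_ring V\<^esub> y = x * y"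
  "\<zero>\<^bsub>mpoly_ring V\<^esub> = 0" "\<one>\<^bsub>mpoly_ring V\<^esub> = 1"
  by (simp_all add: polys_def mpoly_ring_def)

lemma a_inv_mpoly_ring:
  fixes x :: "('v \<Rightarrow>\<^sub>0 nat) \<Rightarrow>\<^sub>0 'k::comm_ring_1"
  assumes x: "x \<in> polys V"
  shows "\<ominus>\<^bsub>mpoly_ring V\<^esub> x = - x"
proof -
  let ?R = "mpoly_ring V :: (('v \<Rightarrow>\<^sub>0 nat) \<Rightarrow>\<^sub>0 'k) ring"
  interpret U: unital_subring "polys V :: (('v \<Rightarrow>\<^sub>0 nat) \<Rightarrow>\<^sub>0 'k) set" by (rule unital_subring_polys)
  interpret cring ?R by (rule cring_mpoly_ring)
  show ?thesis
  proof (rule minus_equality)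
    show "- x \<oplus>\<^bsub>?R\<^esub> x = \<zero>\<^bsub>?R\<^esub>" unfolding mpoly_ring_simps by (rule left_minus)
    show "x \<in> carrier ?R" "- x \<in> carrier ?R"
      unfolding mpoly_ring_simps using x U.uminus_closed[OF x] by this
  qed
qed

lemma ideal_mpoly_ring_iff:
  fixes J :: "(('v \<Rightarrow>\<^sub>0 nat) \<Rightarrow>\<^sub>0 'k::comm_ring_1) set"
  shows "ideal J (mpoly_ring V) \<longleftrightarrow> ring_ideal (polys V) J"
proof
  let ?R = "mpoly_ring V :: (('v \<Rightarrow>\<^sub>0 nat) \<Rightarrow>\<^sub>0 'k) ring"
  assume "ideal J ?R"
  then interpret ideal J ?R .
  show "ring_ideal (polys V) J"
    unfolding ring_ideal_def
  proof (intro conjI ballI)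
    show "J \<subseteq> polys V" using a_subset unfolding mpoly_ring_simps .
    show "0 \<in> J" using additive_subgroup.zero_closed[OF is_additive_subgroup] unfolding mpoly_ring_simps .
    show "x + y \<in> J" if "x \<in> J" "y \<in> J" for x y
      using additive_subgroup.a_closed[OF is_additive_subgroup that] unfolding mpoly_ring_simps .
    show "a * x \<in> J" if "a \<in> polys V" "x \<in> J" for a x
      using I_l_closed[of x a] that unfolding mpoly_ring_simps by blast
  qed
next
  let ?R = "mpoly_ring V :: (('v \<Rightarrow>\<^sub>0 nat) \<Rightarrow>\<^sub>0 'k) ring"
  interpret U: unital_subring "polys V :: (('v \<Rightarrow>\<^sub>0 nat) \<Rightarrow>\<^sub>0 'k) set" by (rule unital_subring_polys)
  interpret cring ?R by (rule cring_mpoly_ring)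
  assume J: "ring_ideal (polys V) J"
  show "ideal J ?R"
  proof (rule idealI)
    show "ring ?R" by (rule ring_axioms)
    show "subgroup J (add_monoid ?R)"
    proof (rule add.subgroupI)
      show "J \<subseteq> carrier ?R" unfolding mpoly_ring_simps using U.ideal_subset[OF J] by blast
      show "J \<noteq> {}" using U.ideal_zero[OF J] by blast
      show "\<ominus>\<^bsub>?R\<^esub> a \<in> J" if "a \<in> J" for a
        unfolding a_inv_mpoly_ring[OF U.ideal_subset[OF J that]] by (rule U.ideal_uminus[OF J that])
      show "a \<oplus>\<^bsub>?R\<^esub> b \<in> J" if "a \<in> J" "b \<in> J" for a b
        unfolding mpoly_ring_simps using that by (rule U.ideal_add[OF J])
    qed
    show "x \<otimes>\<^bsub>?R\<^esub> a \<in> J" if "a \<in> J" "x \<in> carrier ?R" for a x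
      using U.ideal_mult[OF J, of x a] that unfolding mpoly_ring_simps by blast
    show "a \<otimes>\<^bsub>?R\<^esub> x \<in> J" if "a \<in> J" "x \<in> carrier ?R" for a x
      using U.ideal_mult[OF J, of x a] that unfolding mpoly_ring_simps mult.commute[of a x] by blast
  qed
qed

lemma ring_ideal_face_prime: "ring_ideal (polys V) (face_prime V C)"
  unfolding face_prime_def by (intro ring_ideal_monom_ideal) (auto simp: up_closed_def keys_add_nat)

text \<open>Among the terms of \<open>p\<close> and \<open>q\<close> outside the ideal,
  \<open>unique_product\<close> selects two whose exponents have a sum attained only once. The
  coefficient of \<open>p * q\<close> there is a product of two nonzero elements of a
  domain.\<close>

lemma primeideal_face_prime:
  fixes V :: "'v set"
  shows "primeideal (face_prime V C) (mpoly_ring V :: (('v \<Rightarrow>\<^sub>0 nat) \<Rightarrow>\<^sub>0 'k::idom) ring)"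
proof (rule primeidealI)
  let ?R = "mpoly_ring V :: (('v \<Rightarrow>\<^sub>0 nat) \<Rightarrow>\<^sub>0 'k) ring"
  show "ideal (face_prime V C) ?R" unfolding ideal_mpoly_ring_iff by (rule ring_ideal_face_prime)
  show "cring ?R" by (rule cring_mpoly_ring)
  have "(1 :: ('v \<Rightarrow>\<^sub>0 nat) \<Rightarrow>\<^sub>0 'k) \<notin> face_prime V C" by (simp add: face_prime_def monom_ideal_def)
  moreover have "(1 :: ('v \<Rightarrow>\<^sub>0 nat) \<Rightarrow>\<^sub>0 'k) \<in> polys V" by (simp add: mem_polys_iff)
  ultimately show "carrier ?R \<noteq> face_prime V C" unfolding mpoly_ring_simps by blast
  fix p q :: "('v \<Rightarrow>\<^sub>0 nat) \<Rightarrow>\<^sub>0 'k"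
  assume "p \<in> carrier ?R" "q \<in> carrier ?R" "p \<otimes>\<^bsub>?R\<^esub> q \<in> face_prime V C"
  then have pq: "p \<in> polys V" "q \<in> polys V" "p * q \<in> face_prime V C" unfolding mpoly_ring_simps .
  show "p \<in> face_prime V C \<or> q \<in> face_prime V C"
  proof (rule ccontr)
    define A where "A r = {a \<in> Poly_Mapping.keys r. Poly_Mapping.keys a \<inter> C = {}}" for r :: "('v \<Rightarrow>\<^sub>0 nat) \<Rightarrow>\<^sub>0 'k"
    assume "\<not> ?thesis"
    then have "A p \<noteq> {}" "A q \<noteq> {}" using pq unfolding A_def face_prime_def monom_ideal_def by blast+
    moreover have "finite (A p)" "finite (A q)" by (simp_all add: A_def)
    ultimately obtain a b where ab: "a \<in> A p" "b \<in> A q"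
      and u: "\<And>a' b'. a' \<in> A p \<Longrightarrow> b' \<in> A q \<Longrightarrow> a' + b' = a + b \<Longrightarrow> a' = a \<and> b' = b"
      using unique_product[of "A p" "A q"] by metis
    have abC: "Poly_Mapping.keys (a + b) \<inter> C = {}" using ab by (auto simp: A_def keys_add_nat)
    have ab_keys: "a \<in> Poly_Mapping.keys p" "b \<in> Poly_Mapping.keys q" using ab by (simp_all add: A_def)
    \<comment> \<open>Terms of \<open>p\<close> or \<open>q\<close> involving a variable of
      \<open>C\<close> cannot contribute either, because \<open>a + b\<close> avoids
      \<open>C\<close>.\<close>
    have u': "a' = a \<and> b' = b"
      if k: "a' \<in> Poly_Mapping.keys p" "b' \<in> Poly_Mapping.keys q" "a' + b' = a + b" for a' b'
    proof (rule u[OF _ _ k(3)])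
      have "Poly_Mapping.keys (a' + b') \<inter> C = {}" unfolding k(3) by (rule abC)
      then have "Poly_Mapping.keys a' \<inter> C = {}" "Poly_Mapping.keys b' \<inter> C = {}"
        unfolding keys_add_nat by blast+
      then show "a' \<in> A p" "b' \<in> A q" using k by (simp_all add: A_def)
    qed
    let ?s = "\<lambda>r m. Poly_Mapping.single m (Poly_Mapping.lookup r m)"
    have "p * q = (\<Sum>x\<in>Poly_Mapping.keys p. ?s p x) * (\<Sum>y\<in>Poly_Mapping.keys q. ?s q y)"
      by (simp only: poly_expansion)
    also have "\<dots> = (\<Sum>(x, y)\<in>Poly_Mapping.keys p \<times> Poly_Mapping.keys q. Poly_Mapping.single (x + y)
        (Poly_Mapping.lookup p x * Poly_Mapping.lookup q y))"
      by (simp add: sum_product sum.cartesian_product mult_single)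
    finally have "Poly_Mapping.lookup (p * q) (a + b)
        = (\<Sum>(x, y)\<in>Poly_Mapping.keys p \<times> Poly_Mapping.keys q.
            if x + y = a + b then Poly_Mapping.lookup p x * Poly_Mapping.lookup q y else 0)"
      by (simp add: lookup_sum lookup_single when_def case_prod_unfold)
    also have "\<dots> = (\<Sum>(x, y)\<in>{(a, b)}. Poly_Mapping.lookup p x * Poly_Mapping.lookup q y)"
      using ab_keys u' by (intro sum.mono_neutral_cong_right) (auto simp: case_prod_unfold)
    also have "\<dots> = Poly_Mapping.lookup p a * Poly_Mapping.lookup q b" by simp
    finally have "a + b \<in> Poly_Mapping.keys (p * q)"
      using ab_keys by (simp add: in_keys_iff)
    then show False using pq(3) abC unfolding face_prime_def monom_ideal_def by blast
  qed
qed

lemma genideal_mpoly_ring_subset_iff: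
  fixes J :: "(('v \<Rightarrow>\<^sub>0 nat) \<Rightarrow>\<^sub>0 'k::comm_ring_1) set"
  assumes "ideal J (mpoly_ring V)" "B \<subseteq> polys V"
  shows "Idl\<^bsub>mpoly_ring V\<^esub> B \<subseteq> J \<longleftrightarrow> B \<subseteq> J"
proof -
  interpret cring "mpoly_ring V :: (('v \<Rightarrow>\<^sub>0 nat) \<Rightarrow>\<^sub>0 'k) ring" by (rule cring_mpoly_ring)
  show ?thesis using Idl_subset_ideal[OF assms(1)] assms(2) unfolding mpoly_ring_simps by blast
qed

lemma mvar_in_face_prime_iff:
  "v \<in> V \<Longrightarrow> mvar v \<in> (face_prime V C :: (('v \<Rightarrow>\<^sub>0 nat) \<Rightarrow>\<^sub>0 'k::comm_ring_1) set) \<longleftrightarrow> v \<in> C"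
  by (simp add: face_prime_def monom_ideal_def mvar_def mem_polys_iff)

lemma split_mvar:
  assumes "v \<in> Poly_Mapping.keys m"
  shows "Poly_Mapping.single m c = Poly_Mapping.single (m - Poly_Mapping.single v 1) c * mvar v"
proof -
  have "m - Poly_Mapping.single v 1 + Poly_Mapping.single v 1 = m"
    using assms by (intro poly_mapping_eqI) (auto simp: lookup_add lookup_minus lookup_single when_def in_keys_iff)
  then show ?thesis by (simp add: mvar_def mult_single)
qed

lemma keys_diff_nat: "Poly_Mapping.keys (m - n :: 'v \<Rightarrow>\<^sub>0 nat) \<subseteq> Poly_Mapping.keys m"
  by (auto simp: in_keys_iff lookup_minus)

lemma face_prime_subset_ideal:
  fixes J :: "(('v \<Rightarrow>\<^sub>0 nat) \<Rightarrow>\<^sub>0 'k::comm_ring_1) set"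
  assumes J: "ring_ideal (polys V) J" and C: "\<And>v. v \<in> C \<inter> V \<Longrightarrow> mvar v \<in> J"
  shows "face_prime V C \<subseteq> J"
proof
  interpret unital_subring "polys V :: (('v \<Rightarrow>\<^sub>0 nat) \<Rightarrow>\<^sub>0 'k) set" by (rule unital_subring_polys)
  fix p :: "('v \<Rightarrow>\<^sub>0 nat) \<Rightarrow>\<^sub>0 'k" assume p: "p \<in> face_prime V C"
  have "Poly_Mapping.single m c \<in> J" if m: "m \<in> Poly_Mapping.keys p" for m c
  proof -
    have mV: "Poly_Mapping.keys m \<subseteq> V" and "Poly_Mapping.keys m \<inter> C \<noteq> {}"
      using p m unfolding face_prime_def monom_ideal_def mem_polys_iff by blast+
    then obtain v where v: "v \<in> Poly_Mapping.keys m" "v \<in> C \<inter> V" by blast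
    have "Poly_Mapping.single (m - Poly_Mapping.single v 1) c \<in> polys V"
      using mV keys_diff_nat[of m "Poly_Mapping.single v 1"] by (intro single_in_polys) blast
    then show ?thesis using split_mvar[OF v(1), of c] ideal_mult[OF J _ C[OF v(2)]] by simp
  qed
  then have "(\<Sum>m\<in>Poly_Mapping.keys p. Poly_Mapping.single m (Poly_Mapping.lookup p m)) \<in> J"
    by (intro ideal_sum[OF J])
  then show "p \<in> J" by (simp only: poly_expansion)
qed

text \<open>Weight at least 2 allows one variable of \<open>C\<close> to be split off so that the
  remaining monomial still involves \<open>C\<close>.\<close>

lemma face_prime_square:
  assumes C: "C \<subseteq> V" "finite V"
  shows "face_prime V C \<cdot>\<^bsub>mpoly_ring V\<^esub> face_prime V C
      = (monom_ideal V {a. 2 \<le> weight C a} :: (('v \<Rightarrow>\<^sub>0 nat) \<Rightarrow>\<^sub>0 'k::comm_ring_1) set)"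
    (is "?P \<cdot>\<^bsub>?R\<^esub> ?P = ?Q")
proof
  interpret U: unital_subring "polys V :: (('v \<Rightarrow>\<^sub>0 nat) \<Rightarrow>\<^sub>0 'k) set" by (rule unital_subring_polys)
  interpret cring ?R by (rule cring_mpoly_ring)
  have finC: "finite C" using C finite_subset by blast
  have "up_closed {a :: 'v \<Rightarrow>\<^sub>0 nat. 2 \<le> weight C a}"
    unfolding up_closed_def by (auto simp: weight_add intro: trans_le_add1)
  then have Q: "ring_ideal (polys V) ?Q" by (rule ring_ideal_monom_ideal)
  show "?P \<cdot>\<^bsub>?R\<^esub> ?P \<subseteq> ?Q"
  proof
    fix x assume "x \<in> ?P \<cdot>\<^bsub>?R\<^esub> ?P"
    then show "x \<in> ?Q"
    proof (induction rule: ideal_prod.induct)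
      case (prod p q)
      have "2 \<le> weight C m" if m: "m \<in> Poly_Mapping.keys (p * q)" for m
      proof -
        obtain a b where ab: "m = a + b" "a \<in> Poly_Mapping.keys p" "b \<in> Poly_Mapping.keys q"
          using m keys_mult[of p q] by blast
        have "Poly_Mapping.keys a \<inter> C \<noteq> {}" "Poly_Mapping.keys b \<inter> C \<noteq> {}"
          using ab prod unfolding face_prime_def monom_ideal_def by blast+
        then have "weight C a \<noteq> 0" "weight C b \<noteq> 0" using finC by (simp_all add: weight_eq_0_iff)
        then show ?thesis by (simp add: ab(1) weight_add)
      qed
      moreover have "p * q \<in> polys V"
        using prod unfolding face_prime_def monom_ideal_def by (intro U.mult_closed) simp_all
      ultimately show ?case unfolding mpoly_ring_simps monom_ideal_def by blast
    next
      case (sum p q)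
      then show ?case unfolding mpoly_ring_simps by (intro U.ideal_add[OF Q])
    qed
  qed
  have PI: "ideal ?P ?R" unfolding ideal_mpoly_ring_iff by (rule ring_ideal_face_prime)
  have PP: "ring_ideal (polys V) (?P \<cdot>\<^bsub>?R\<^esub> ?P)"
    unfolding ideal_mpoly_ring_iff[symmetric] by (rule ideal_prod_is_ideal[OF PI PI])
  show "?Q \<subseteq> ?P \<cdot>\<^bsub>?R\<^esub> ?P"
  proof
    fix p assume p: "p \<in> ?Q"
    have "Poly_Mapping.single m c \<in> ?P \<cdot>\<^bsub>?R\<^esub> ?P" if m: "m \<in> Poly_Mapping.keys p" for m c
    proof -
      have mV: "Poly_Mapping.keys m \<subseteq> V" and w: "2 \<le> weight C m"
        using p m unfolding monom_ideal_def mem_polys_iff by blast+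
      have "weight C m \<noteq> 0" using w by simp
      then obtain v where v: "v \<in> Poly_Mapping.keys m" "v \<in> C" using finC by (auto simp: weight_eq_0_iff)
      let ?m = "m - Poly_Mapping.single v 1"
      have "?m + Poly_Mapping.single v 1 = m"
        using v by (intro poly_mapping_eqI) (auto simp: lookup_add lookup_minus lookup_single when_def in_keys_iff)
      then have "weight C m = weight C ?m + 1"
        using weight_add[of C ?m "Poly_Mapping.single v 1"] v finC by (simp add: weight_single[unfolded One_nat_def])
      then have "weight C ?m \<noteq> 0" using w by simp
      then have "Poly_Mapping.keys ?m \<inter> C \<noteq> {}" using finC by (simp add: weight_eq_0_iff)
      moreover have "Poly_Mapping.keys ?m \<subseteq> V" using mV keys_diff_nat[of m "Poly_Mapping.single v 1"] by blast
      ultimately have "Poly_Mapping.single ?m c \<in> ?P"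
        unfolding face_prime_def by (intro single_in_monom_ideal) simp_all
      moreover have "v \<in> V" using v C by blast
      then have "(mvar v :: ('v \<Rightarrow>\<^sub>0 nat) \<Rightarrow>\<^sub>0 'k) \<in> ?P" using v by (simp add: mvar_in_face_prime_iff)
      ultimately have "Poly_Mapping.single ?m c \<otimes>\<^bsub>?R\<^esub> mvar v \<in> ?P \<cdot>\<^bsub>?R\<^esub> ?P" by (rule ideal_prod.prod)
      then show ?thesis unfolding mpoly_ring_simps split_mvar[OF v(1), of c] .
    qed
    then have "(\<Sum>m\<in>Poly_Mapping.keys p. Poly_Mapping.single m (Poly_Mapping.lookup p m)) \<in> ?P \<cdot>\<^bsub>?R\<^esub> ?P"
      by (intro U.ideal_sum[OF PP])
    then show "p \<in> ?P \<cdot>\<^bsub>?R\<^esub> ?P" by (simp only: poly_expansion)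
  qed
qed


section \<open>Minimal primes of the edge ideal and vertex covers\<close>

context bounded_degree_graph
begin

definition edge_monom_ideal :: "'k::comm_ring_1 itself \<Rightarrow> (('v \<Rightarrow>\<^sub>0 nat) \<Rightarrow>\<^sub>0 'k) set" where
  "edge_monom_ideal K = Idl\<^bsub>mpoly_ring V\<^esub> {mvar v * mvar w | v w. w \<in> N v}"

lemma N_in_V: "w \<in> N v \<Longrightarrow> v \<in> V \<and> w \<in> V"
  using N_subset N_sym by blast

lemma edge_monom_ideal_subset_iff:
  fixes J :: "(('v \<Rightarrow>\<^sub>0 nat) \<Rightarrow>\<^sub>0 'k::comm_ring_1) set"
  assumes "ideal J (mpoly_ring V)"
  shows "edge_monom_ideal TYPE('k) \<subseteq> J \<longleftrightarrow> (\<forall>v w. w \<in> N v \<longrightarrow> mvar v * mvar w \<in> J)"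
proof -
  interpret unital_subring "polys V :: (('v \<Rightarrow>\<^sub>0 nat) \<Rightarrow>\<^sub>0 'k) set" by (rule unital_subring_polys)
  have "mvar v * mvar w \<in> (polys V :: (('v \<Rightarrow>\<^sub>0 nat) \<Rightarrow>\<^sub>0 'k) set)" if "w \<in> N v" for v w
    using N_in_V[OF that] by (intro mult_closed mvar_in_polys) blast+
  then have "{mvar v * mvar w | v w. w \<in> N v} \<subseteq> (polys V :: (('v \<Rightarrow>\<^sub>0 nat) \<Rightarrow>\<^sub>0 'k) set)"
    by blast
  then have "edge_monom_ideal TYPE('k) \<subseteq> J \<longleftrightarrow> {mvar v * mvar w | v w. w \<in> N v} \<subseteq> J"
    unfolding edge_monom_ideal_def by (rule genideal_mpoly_ring_subset_iff[OF assms])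
  also have "\<dots> \<longleftrightarrow> (\<forall>v w. w \<in> N v \<longrightarrow> mvar v * mvar w \<in> J)" by blast
  finally show ?thesis .
qed

definition vertex_cover :: "'v set \<Rightarrow> bool" where
  "vertex_cover C \<longleftrightarrow> C \<subseteq> V \<and> (\<forall>v w. w \<in> N v \<longrightarrow> v \<in> C \<or> w \<in> C)"

lemma vertex_cover_iff_indep: "C \<subseteq> V \<Longrightarrow> vertex_cover C \<longleftrightarrow> indep (V - C)"
  unfolding vertex_cover_def indep_def using N_in_V by blast

lemma edge_monom_ideal_subset_prime:
  fixes Q :: "(('v \<Rightarrow>\<^sub>0 nat) \<Rightarrow>\<^sub>0 'k::idom) set"
  assumes Q: "primeideal Q (mpoly_ring V)"
  shows "edge_monom_ideal TYPE('k) \<subseteq> Q \<longleftrightarrow> vertex_cover {v \<in> V. mvar v \<in> Q}"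
proof -
  have id: "ideal Q (mpoly_ring V)" using Q by (rule primeideal.axioms(1))
  have J: "ring_ideal (polys V) Q" using id by (simp only: ideal_mpoly_ring_iff)
  interpret unital_subring "polys V :: (('v \<Rightarrow>\<^sub>0 nat) \<Rightarrow>\<^sub>0 'k) set" by (rule unital_subring_polys)
  have "mvar v * mvar w \<in> Q \<longleftrightarrow> mvar v \<in> Q \<or> mvar w \<in> Q" if "w \<in> N v" for v w
  proof -
    have m: "mvar v \<in> polys V" "mvar w \<in> polys V"
      using N_in_V[OF that] by (simp_all add: mvar_in_polys)
    show ?thesis
    proof
      assume "mvar v * mvar w \<in> Q"
      then show "mvar v \<in> Q \<or> mvar w \<in> Q"
        using primeideal.I_prime[OF Q, of "mvar v" "mvar w"] m unfolding mpoly_ring_simps by blast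
    next
      assume "mvar v \<in> Q \<or> mvar w \<in> Q"
      then show "mvar v * mvar w \<in> Q"
        using ideal_mult[OF J m(1), of "mvar w"] ideal_mult[OF J m(2), of "mvar v"]
          mult.commute[of "mvar v" "mvar w"] by metis
    qed
  qed
  then show ?thesis
    unfolding edge_monom_ideal_subset_iff[OF id] vertex_cover_def using N_in_V by blast
qed

lemma minimal_prime_face_prime:
  assumes C: "vertex_cover C" and min: "\<And>C'. vertex_cover C' \<Longrightarrow> C' \<subseteq> C \<Longrightarrow> C' = C"
  shows "(face_prime V C :: (('v \<Rightarrow>\<^sub>0 nat) \<Rightarrow>\<^sub>0 'k::idom) set)
    \<in> minimal_primes (mpoly_ring V) (edge_monom_ideal TYPE('k))"
  unfolding minimal_primes_def
proof (intro CollectI conjI allI impI)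
  let ?P = "face_prime V C :: (('v \<Rightarrow>\<^sub>0 nat) \<Rightarrow>\<^sub>0 'k) set"
  have CV: "C \<subseteq> V" using C by (simp add: vertex_cover_def)
  show P: "primeideal ?P (mpoly_ring V)" by (rule primeideal_face_prime)
  have PC: "mvar v \<in> ?P \<longleftrightarrow> v \<in> C" if "v \<in> V" for v by (rule mvar_in_face_prime_iff[OF that])
  have "{v \<in> V. mvar v \<in> ?P} = C" using CV PC by blast
  then show "edge_monom_ideal TYPE('k) \<subseteq> ?P"
    unfolding edge_monom_ideal_subset_prime[OF P] using C by simp
  fix Q :: "(('v \<Rightarrow>\<^sub>0 nat) \<Rightarrow>\<^sub>0 'k) set"
  assume Q: "primeideal Q (mpoly_ring V) \<and> edge_monom_ideal TYPE('k) \<subseteq> Q \<and> Q \<subseteq> ?P"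
  then have pQ: "primeideal Q (mpoly_ring V)" by blast
  let ?C = "{v \<in> V. mvar v \<in> Q}"
  have "vertex_cover ?C" using Q edge_monom_ideal_subset_prime[OF pQ] by blast
  moreover have "?C \<subseteq> C" using Q PC by blast
  ultimately have eq: "?C = C" by (rule min)
  have "ring_ideal (polys V) Q"
    using primeideal.axioms(1)[OF pQ] by (simp only: ideal_mpoly_ring_iff)
  then have "?P \<subseteq> Q" by (rule face_prime_subset_ideal) (use eq in blast)
  then show "Q = ?P" using Q by blast
qed

text \<open>The variables in \<open>P\<close> form a vertex cover, and the prime they generate lies
  between the edge ideal and \<open>P\<close>.\<close>

lemma minimal_prime_cases:
  fixes P :: "(('v \<Rightarrow>\<^sub>0 nat) \<Rightarrow>\<^sub>0 'k::idom) set"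
  assumes "P \<in> minimal_primes (mpoly_ring V) (edge_monom_ideal TYPE('k))"
  obtains C where "vertex_cover C" "P = face_prime V C"
proof -
  have P: "primeideal P (mpoly_ring V)" "edge_monom_ideal TYPE('k) \<subseteq> P"
    and min: "\<And>Q. primeideal Q (mpoly_ring V) \<Longrightarrow> edge_monom_ideal TYPE('k) \<subseteq> Q \<Longrightarrow> Q \<subseteq> P \<Longrightarrow> Q = P"
    using assms unfolding minimal_primes_def by blast+
  let ?C = "{v \<in> V. mvar v \<in> P}"
  let ?Q = "face_prime V ?C :: (('v \<Rightarrow>\<^sub>0 nat) \<Rightarrow>\<^sub>0 'k) set"
  have C: "vertex_cover ?C" using P edge_monom_ideal_subset_prime[OF P(1)] by blast
  have Q: "primeideal ?Q (mpoly_ring V)" by (rule primeideal_face_prime)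
  have "mvar v \<in> ?Q \<longleftrightarrow> v \<in> ?C" if "v \<in> V" for v by (rule mvar_in_face_prime_iff[OF that])
  then have "{v \<in> V. mvar v \<in> ?Q} = ?C" by blast
  then have "edge_monom_ideal TYPE('k) \<subseteq> ?Q"
    unfolding edge_monom_ideal_subset_prime[OF Q] using C by simp
  moreover have "ring_ideal (polys V) P"
    using primeideal.axioms(1)[OF P(1)] by (simp only: ideal_mpoly_ring_iff)
  then have "?Q \<subseteq> P" by (rule face_prime_subset_ideal) blast
  ultimately have "?Q = P" by (rule min[OF Q])
  then show ?thesis using that C by blast
qed

lemma minimal_vertex_cover_below:
  assumes "vertex_cover C"
  obtains C' where "vertex_cover C'" "C' \<subseteq> C" "\<forall>C''. vertex_cover C'' \<longrightarrow> C'' \<subseteq> C' \<longrightarrow> C'' = C'"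
proof -
  have "finite {C'. vertex_cover C' \<and> C' \<subseteq> C}"
    by (rule finite_subset[of _ "Pow V"]) (use finite_V in \<open>auto simp: vertex_cover_def\<close>)
  from finite_has_minimal2[OF this, of C]
  obtain C' where C': "C' \<in> {C'. vertex_cover C' \<and> C' \<subseteq> C}"
    and "\<forall>b\<in>{C'. vertex_cover C' \<and> C' \<subseteq> C}. b \<subseteq> C' \<longrightarrow> C' = b"
    using assms by blast
  then have "C'' = C'" if "vertex_cover C''" "C'' \<subseteq> C'" for C'' using that by blast
  then show ?thesis using that C' by blast
qed

lemma weight_mono: "A \<subseteq> B \<Longrightarrow> finite B \<Longrightarrow> weight A a \<le> weight B a"
  unfolding weight_def by (rule sum_mono2) simp_all

text \<open>The independent sets in \<open>symbolic_exponents\<close> need not be maximal. For the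
  first inclusion, a minimal cover inside \<open>V - F\<close> yields a minimal prime whose weight
  bound is the stronger one. For the second, every minimal prime comes from some vertex cover, whose
  complement is independent.\<close>

lemma second_symbolic_power_edge_monom_ideal:
  "second_symbolic_power (mpoly_ring V) (edge_monom_ideal TYPE('k))
    = (monom_ideal V symbolic_exponents :: (('v \<Rightarrow>\<^sub>0 nat) \<Rightarrow>\<^sub>0 'k::idom) set)"
    (is "?L = ?R")
proof
  let ?min = "minimal_primes (mpoly_ring V) (edge_monom_ideal TYPE('k))"
  have sq: "face_prime V C \<cdot>\<^bsub>mpoly_ring V\<^esub> face_prime V C
      = (monom_ideal V {a. 2 \<le> weight C a} :: (('v \<Rightarrow>\<^sub>0 nat) \<Rightarrow>\<^sub>0 'k) set)" if "vertex_cover C" for C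
    using that by (intro face_prime_square finite_V) (simp add: vertex_cover_def)
  have below: "\<exists>C. vertex_cover C \<and> C \<subseteq> V - F \<and> (p \<in> monom_ideal V {a. 2 \<le> weight C a})"
    if p: "p \<in> ?L" and F: "F \<subseteq> V" "indep F" for p :: "('v \<Rightarrow>\<^sub>0 nat) \<Rightarrow>\<^sub>0 'k" and F
  proof -
    have "V - (V - F) = F" using F(1) by blast
    then have cover: "vertex_cover (V - F)" using F vertex_cover_iff_indep[of "V - F"] by simp
    from cover obtain C where C: "vertex_cover C" "C \<subseteq> V - F"
      and min: "\<forall>C'. vertex_cover C' \<longrightarrow> C' \<subseteq> C \<longrightarrow> C' = C"
      by (rule minimal_vertex_cover_below)
    have "face_prime V C \<in> ?min" by (rule minimal_prime_face_prime[OF C(1)]) (use min in blast)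
    then have "p \<in> face_prime V C \<cdot>\<^bsub>mpoly_ring V\<^esub> face_prime V C"
      using p unfolding second_symbolic_power_def by blast
    then show ?thesis using C unfolding sq[OF C(1)] by blast
  qed
  show "?L \<subseteq> ?R"
  proof
    fix p assume p: "p \<in> ?L"
    \<comment> \<open>The empty independent set provides at least one minimal prime; an intersection
      over no primes would not be confined to \<open>polys V\<close>.\<close>
    have "indep {}" by (simp add: indep_def)
    then have "p \<in> polys V" using below[OF p, of "{}"] unfolding monom_ideal_def by blast
    moreover have "2 \<le> weight (V - F) a" if a: "a \<in> Poly_Mapping.keys p" and F: "F \<subseteq> V" "indep F" for a F
    proof -
      obtain C where C: "C \<subseteq> V - F" "p \<in> monom_ideal V {a. 2 \<le> weight C a}" using below[OF p F] by blast
      then have "2 \<le> weight C a" using a unfolding monom_ideal_def by blast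
      also have "\<dots> \<le> weight (V - F) a" using C finite_V by (intro weight_mono) simp_all
      finally show ?thesis .
    qed
    ultimately show "p \<in> ?R" unfolding monom_ideal_def symbolic_exponents_def by blast
  qed
  show "?R \<subseteq> ?L"
    unfolding second_symbolic_power_def
  proof (intro subsetI INT_I)
    fix p P assume p: "p \<in> ?R" and P: "P \<in> ?min"
    from P obtain C where C: "vertex_cover C" "P = face_prime V C" by (rule minimal_prime_cases)
    have CV: "C \<subseteq> V" using C(1) by (simp add: vertex_cover_def)
    have "indep (V - C)" using C(1) vertex_cover_iff_indep[OF CV] by blast
    then have "symbolic_exponents \<subseteq> {a. 2 \<le> weight (V - (V - C)) a}"
      unfolding symbolic_exponents_def using Diff_subset[of V C] by blast
    moreover have "V - (V - C) = C" using CV by blast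
    ultimately have "symbolic_exponents \<subseteq> {a. 2 \<le> weight C a}" by simp
    then show "p \<in> P \<cdot>\<^bsub>mpoly_ring V\<^esub> P"
      using p unfolding C(2) sq[OF C(1)] monom_ideal_def by blast
  qed
qed

end


section \<open>Regular sequences on the residue class ring\<close>

context
  fixes V :: "'v set" and J :: "(('v \<Rightarrow>\<^sub>0 nat) \<Rightarrow>\<^sub>0 'k::comm_ring_1) set"
  assumes J: "ring_ideal (polys V) J"
begin

private abbreviation (input) R :: "(('v \<Rightarrow>\<^sub>0 nat) \<Rightarrow>\<^sub>0 'k) ring" where "R \<equiv> mpoly_ring V"
private abbreviation (input) M where "M \<equiv> quot_module (mpoly_ring V) J"
private abbreviation (input) residue where "residue p \<equiv> J +>\<^bsub>mpoly_ring V\<^esub> p"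

interpretation unital_subring "polys V :: (('v \<Rightarrow>\<^sub>0 nat) \<Rightarrow>\<^sub>0 'k) set" by (rule unital_subring_polys)

lemma idealJ: "ideal J R"
  unfolding ideal_mpoly_ring_iff by (rule J)

lemma residue_hom: "ring_hom_ring R (R Quot J) (\<lambda>p. residue p)"
  using ideal.rcos_ring_hom_ring[OF idealJ] .

lemma residue_add: "p \<in> polys V \<Longrightarrow> q \<in> polys V \<Longrightarrow> residue (p + q) = residue p \<oplus>\<^bsub>M\<^esub> residue q"
  using ring_hom_ring.homh[OF residue_hom] ring_hom_add[of "(\<lambda>p. residue p)" R "R Quot J" p q]
  by (simp add: quot_module_def mpoly_ring_simps)

lemma residue_smult: "p \<in> polys V \<Longrightarrow> q \<in> polys V \<Longrightarrow> residue (p * q) = p \<odot>\<^bsub>M\<^esub> residue q"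
  using ring_hom_ring.homh[OF residue_hom] ring_hom_mult[of "(\<lambda>p. residue p)" R "R Quot J" p q]
  by (simp add: quot_module_def mpoly_ring_simps)

lemma carrier_quot_module: "carrier M = (\<lambda>p. residue p) ` polys V"
  by (auto simp: quot_module_def FactRing_def A_RCOSETS_def' mpoly_ring_simps)

lemma residue_eq_iff: "p \<in> polys V \<Longrightarrow> q \<in> polys V \<Longrightarrow> residue p = residue q \<longleftrightarrow> p - q \<in> J"
proof -
  assume pq: "p \<in> polys V" "q \<in> polys V"
  interpret R: cring "mpoly_ring V :: (('v \<Rightarrow>\<^sub>0 nat) \<Rightarrow>\<^sub>0 'k) ring" by (rule cring_mpoly_ring)
  have "p \<ominus>\<^bsub>R\<^esub> q = p - q" using pq by (simp add: a_minus_def a_inv_mpoly_ring mpoly_ring_simps)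
  then show ?thesis using R.quotient_eq_iff_same_a_r_cos[OF idealJ, of p q] pq by (simp add: mpoly_ring_simps)
qed

lemma residue_image_iff:
  assumes L: "ring_ideal (polys V) L" "J \<subseteq> L" and p: "p \<in> polys V"
  shows "residue p \<in> (\<lambda>p. residue p) ` L \<longleftrightarrow> p \<in> L"
proof
  assume "residue p \<in> (\<lambda>p. residue p) ` L"
  then obtain q where q: "q \<in> L" "residue p = residue q" by blast
  have "p - q \<in> J" using residue_eq_iff[OF p ideal_subset[OF L(1) q(1)]] q(2) by blast
  then have "(p - q) + q \<in> L" using L(2) q(1) by (intro ideal_add[OF L(1)]) blast+
  then show "p \<in> L" by simp
qed blast

lemma finsum_residue:
  assumes "\<And>i :: nat. i < n \<Longrightarrow> h i \<in> polys V"
  shows "(\<Oplus>\<^bsub>M\<^esub>i\<in>{..<n}. residue (h i)) = residue (\<Sum>i<n. h i)"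
  using assms
proof (induction n)
  case 0
  interpret M: module R M by (rule module_quot_module[OF cring_mpoly_ring idealJ])
  have "residue 0 = \<zero>\<^bsub>M\<^esub>"
    using ring_hom_zero[OF ring_hom_ring.homh[OF residue_hom]] ring_hom_ring.axioms(1,2)[OF residue_hom]
    by (simp add: quot_module_def mpoly_ring_simps)
  then show ?case by simp
next
  case (Suc n)
  interpret M: module R M by (rule module_quot_module[OF cring_mpoly_ring idealJ])
  have h: "residue (h i) \<in> carrier M" if "i < Suc n" for i
    unfolding carrier_quot_module using Suc.prems[OF that] by blast
  have "(\<Oplus>\<^bsub>M\<^esub>i\<in>{..<Suc n}. residue (h i)) = residue (h n) \<oplus>\<^bsub>M\<^esub> (\<Oplus>\<^bsub>M\<^esub>i\<in>{..<n}. residue (h i))"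
    unfolding lessThan_Suc using h by (intro M.finsum_insert) auto
  also have "\<dots> = residue (h n) \<oplus>\<^bsub>M\<^esub> residue (\<Sum>i<n. h i)" using Suc by simp
  also have "\<dots> = residue (h n + (\<Sum>i<n. h i))"
    using Suc.prems by (intro residue_add[symmetric] sum_closed) simp_all
  finally show ?case by (simp add: add.commute)
qed

text \<open>Coefficients in the quotient are lifted to polynomials, and the summand from
  \<open>J\<close> disappears in the residue.\<close>

lemma seq_submodule_quot_module:
  assumes fs: "set fs \<subseteq> polys V"
  shows "seq_submodule M fs = (\<lambda>p. residue p) ` ideal_plus (polys V) J fs"
proof -
  have f: "fs ! i \<in> polys V" if "i < length fs" for i using fs that by auto
  have sum: "(\<Oplus>\<^bsub>M\<^esub>i\<in>{..<length fs}. fs ! i \<odot>\<^bsub>M\<^esub> x i) = residue (\<Sum>i<length fs. fs ! i * a i)"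
    if a: "a \<in> {..<length fs} \<rightarrow> polys V" and x: "\<And>i. i < length fs \<Longrightarrow> x i = residue (a i)" for x a
  proof -
    interpret M: module R M by (rule module_quot_module[OF cring_mpoly_ring idealJ])
    have ai: "a i \<in> polys V" if "i < length fs" for i using a that by blast
    have h: "fs ! i * a i \<in> polys V" if "i < length fs" for i
      by (rule mult_closed[OF f[OF that] ai[OF that]])
    have "fs ! i \<odot>\<^bsub>M\<^esub> x i = residue (fs ! i * a i)" if "i < length fs" for i
      unfolding x[OF that] by (rule residue_smult[OF f[OF that] ai[OF that], symmetric])
    moreover have "residue (fs ! i * a i) \<in> carrier M" if "i < length fs" for i
      unfolding carrier_quot_module using h[OF that] by blast
    ultimately have "(\<Oplus>\<^bsub>M\<^esub>i\<in>{..<length fs}. fs ! i \<odot>\<^bsub>M\<^esub> x i) = (\<Oplus>\<^bsub>M\<^esub>i\<in>{..<length fs}. residue (fs ! i * a i))"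
      by (intro M.finsum_cong') auto
    also have "\<dots> = residue (\<Sum>i<length fs. fs ! i * a i)" by (rule finsum_residue[OF h])
    finally show ?thesis .
  qed
  have sum_polys: "(\<Sum>i<length fs. fs ! i * a i) \<in> polys V" if "a \<in> {..<length fs} \<rightarrow> polys V" for a
    using that by (intro sum_closed mult_closed f) auto
  show ?thesis
  proof
    show "seq_submodule M fs \<subseteq> (\<lambda>p. residue p) ` ideal_plus (polys V) J fs"
    proof
      fix y assume "y \<in> seq_submodule M fs"
      then obtain x where x: "y = (\<Oplus>\<^bsub>M\<^esub>i\<in>{..<length fs}. fs ! i \<odot>\<^bsub>M\<^esub> x i)" "x \<in> {..<length fs} \<rightarrow> carrier M"
        unfolding seq_submodule_def by blast
      have "\<forall>i<length fs. \<exists>p\<in>polys V. x i = residue p" using x(2) unfolding carrier_quot_module by blast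
      then obtain a where a: "\<And>i. i < length fs \<Longrightarrow> a i \<in> polys V" "\<And>i. i < length fs \<Longrightarrow> x i = residue (a i)"
        by metis
      then have aP: "a \<in> {..<length fs} \<rightarrow> polys V" by auto
      have "0 + (\<Sum>i<length fs. fs ! i * a i) \<in> ideal_plus (polys V) J fs"
        unfolding ideal_plus_eq_sums[OF J] using aP ideal_zero[OF J] by blast
      moreover have "y = residue (\<Sum>i<length fs. fs ! i * a i)"
        unfolding x(1) by (rule sum[OF aP a(2)])
      ultimately show "y \<in> (\<lambda>p. residue p) ` ideal_plus (polys V) J fs" by simp
    qed
    show "(\<lambda>p. residue p) ` ideal_plus (polys V) J fs \<subseteq> seq_submodule M fs"
    proof
      fix y assume "y \<in> (\<lambda>p. residue p) ` ideal_plus (polys V) J fs"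
      then obtain j a where y: "y = residue (j + (\<Sum>i<length fs. fs ! i * a i))"
        and j: "j \<in> J" and a: "a \<in> {..<length fs} \<rightarrow> polys V"
        unfolding ideal_plus_eq_sums[OF J] by blast
      let ?s = "\<Sum>i<length fs. fs ! i * a i"
      have "y = residue ?s"
        unfolding y using residue_eq_iff[of "j + ?s" ?s] j ideal_subset[OF J j] sum_polys[OF a] add_closed by simp
      then have "y = (\<Oplus>\<^bsub>M\<^esub>i\<in>{..<length fs}. fs ! i \<odot>\<^bsub>M\<^esub> residue (a i))"
        using sum[OF a, of "\<lambda>i. residue (a i)"] by simp
      moreover have "(\<lambda>i. residue (a i)) \<in> {..<length fs} \<rightarrow> carrier M"
        using a unfolding carrier_quot_module by blast
      ultimately show "y \<in> seq_submodule M fs"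
        unfolding seq_submodule_def by (intro CollectI exI[of _ "\<lambda>i. residue (a i)"] conjI)
    qed
  qed
qed

lemma regular_sequence_quot_module:
  assumes fs: "set fs \<subseteq> polys V" and reg: "weakly_regular (polys V) J fs"
    and proper: "ideal_plus (polys V) J fs \<noteq> polys V"
  shows "regular_sequence M fs"
proof -
  have take: "set (take i fs) \<subseteq> polys V" for i using fs set_take_subset[of i fs] by blast
  have L: "ring_ideal (polys V) (ideal_plus (polys V) J gs)" "J \<subseteq> ideal_plus (polys V) J gs"
    if "set gs \<subseteq> polys V" for gs
    using ideal_ideal_plus[OF J that] subset_ideal_plus[OF J that] by blast+
  have "x \<in> seq_submodule M (take i fs)"
    if i: "i < length fs" and x: "x \<in> carrier M" and fx: "fs ! i \<odot>\<^bsub>M\<^esub> x \<in> seq_submodule M (take i fs)" for i x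
  proof -
    obtain p where p: "p \<in> polys V" "x = residue p" using x unfolding carrier_quot_module by blast
    have f: "fs ! i \<in> polys V" using fs i by auto
    have "residue (fs ! i * p) \<in> (\<lambda>p. residue p) ` ideal_plus (polys V) J (take i fs)"
      using fx unfolding p(2) seq_submodule_quot_module[OF take] residue_smult[OF f p(1)] .
    then have "fs ! i * p \<in> ideal_plus (polys V) J (take i fs)"
      using residue_image_iff[OF L[OF take] mult_closed[OF f p(1)]] by blast
    then have "p \<in> ideal_plus (polys V) J (take i fs)"
      using reg i p(1) unfolding weakly_regular_iff_nth nonzerodivisor_mod_def by blast
    then show ?thesis unfolding p(2) seq_submodule_quot_module[OF take] by blast
  qed
  moreover have "seq_submodule M fs \<noteq> carrier M"
  proof
    assume eq: "seq_submodule M fs = carrier M"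
    have "p \<in> ideal_plus (polys V) J fs" if p: "p \<in> polys V" for p
      using eq p residue_image_iff[OF L[OF fs] p]
      unfolding seq_submodule_quot_module[OF fs] carrier_quot_module by blast
    then have "ideal_plus (polys V) J fs = polys V" using ideal_subset[OF L(1)[OF fs]] by blast
    then show False using proper by contradiction
  qed
  ultimately show ?thesis unfolding regular_sequence_def by blast
qed

end


section \<open>Properness and the bound for the depth\<close>

lemma elem_sym_in_face_prime:
  fixes V :: "'v set"
  assumes "finite V" "0 < i"
  shows "elem_sym V i \<in> (face_prime V V :: (('v \<Rightarrow>\<^sub>0 nat) \<Rightarrow>\<^sub>0 'k::comm_ring_1) set)"
proof -
  interpret unital_subring "polys V :: (('v \<Rightarrow>\<^sub>0 nat) \<Rightarrow>\<^sub>0 'k) set" by (rule unital_subring_polys)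
  have P: "ring_ideal (polys V) (face_prime V V :: (('v \<Rightarrow>\<^sub>0 nat) \<Rightarrow>\<^sub>0 'k) set)" by (rule ring_ideal_face_prime)
  show ?thesis
    unfolding elem_sym_def
  proof (rule ideal_sum[OF P])
    fix T assume "T \<in> {T. T \<subseteq> V \<and> card T = i}"
    then have T: "T \<subseteq> V" "card T = i" by simp_all
    have finT: "finite T" using T(1) assms(1) finite_subset by blast
    have "T \<noteq> {}" using T(2) assms(2) by auto
    then obtain v where v: "v \<in> T" by blast
    have vV: "v \<in> V" using v T(1) by blast
    have "(\<Prod>v\<in>T - {v}. mvar v) * mvar v \<in> (face_prime V V :: (('v \<Rightarrow>\<^sub>0 nat) \<Rightarrow>\<^sub>0 'k) set)"
    proof (rule ideal_mult[OF P])
      show "(\<Prod>v\<in>T - {v}. mvar v) \<in> (polys V :: (('v \<Rightarrow>\<^sub>0 nat) \<Rightarrow>\<^sub>0 'k) set)"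
        by (rule prod_mvar_in_polys) (use T in blast)
      show "mvar v \<in> (face_prime V V :: (('v \<Rightarrow>\<^sub>0 nat) \<Rightarrow>\<^sub>0 'k) set)"
        unfolding mvar_in_face_prime_iff[OF vV] by (rule vV)
    qed
    then show "(\<Prod>v\<in>T. mvar v) \<in> (face_prime V V :: (('v \<Rightarrow>\<^sub>0 nat) \<Rightarrow>\<^sub>0 'k) set)"
      unfolding prod.remove[OF finT v] by (simp add: mult.commute)
  qed
qed

lemma (in unital_subring) ideal_plus_subset:
  assumes L: "ring_ideal C L" and "J \<subseteq> L" "set fs \<subseteq> L"
  shows "ideal_plus C J fs \<subseteq> L"
  using assms(2,3)
proof (induction fs arbitrary: J)
  case (Cons f fs)
  have f: "f \<in> L" "set fs \<subseteq> L" using Cons.prems(2) by simp_all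
  have "adjoin C J f \<subseteq> L"
  proof
    fix x assume "x \<in> adjoin C J f"
    then obtain j a where x: "x = j + f * a" "j \<in> J" "a \<in> C"
      unfolding adjoin_def by blast
    have "a * f \<in> L" using x(3) f(1) by (rule ideal_mult[OF L])
    then have "f * a \<in> L" by (simp add: mult.commute)
    moreover have "j \<in> L" using Cons.prems(1) x(2) by blast
    ultimately show "x \<in> L" unfolding x(1) by (rule ideal_add[OF L, rotated])
  qed
  then show ?case unfolding ideal_plus.simps using f(2) by (rule Cons.IH)
qed simp

text \<open>\<open>face_prime V V\<close> is the graded maximal ideal described by exponents. It
  contains the symbolic power and the sequence but not 1, which gives properness.\<close>

lemma (in bounded_degree_graph) depth_second_symbolic_power:
  assumes t: "2 * d * t < card V + 2 * d"
  shows "enat t \<le> depth (graded_maximal_ideal V)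
    (quot_module (mpoly_ring V) (second_symbolic_power (mpoly_ring V) (edge_monom_ideal TYPE('k::idom))))"
proof -
  let ?J = "monom_ideal V symbolic_exponents :: (('v \<Rightarrow>\<^sub>0 nat) \<Rightarrow>\<^sub>0 'k) set"
  let ?P = "face_prime V V :: (('v \<Rightarrow>\<^sub>0 nat) \<Rightarrow>\<^sub>0 'k) set"
  let ?fs = "elem_syms V t :: (('v \<Rightarrow>\<^sub>0 nat) \<Rightarrow>\<^sub>0 'k) list"
  interpret unital_subring "polys V :: (('v \<Rightarrow>\<^sub>0 nat) \<Rightarrow>\<^sub>0 'k) set" by (rule unital_subring_polys)
  have J: "ring_ideal (polys V) ?J" by (rule ring_ideal_monom_ideal[OF up_closed_symbolic_exponents])
  have P: "ring_ideal (polys V) ?P" by (rule ring_ideal_face_prime)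
  have fsP: "set ?fs \<subseteq> ?P"
  proof
    fix x assume "x \<in> set ?fs"
    then obtain i where "x = elem_sym V i" "i \<in> set [1..<Suc t]" unfolding elem_syms_def by force
    then have x: "x = elem_sym V i" "0 < i" by auto
    show "x \<in> ?P" unfolding x(1) by (rule elem_sym_in_face_prime[OF finite_V x(2)])
  qed
  have "symbolic_exponents \<subseteq> {a. Poly_Mapping.keys a \<inter> V \<noteq> {}}"
  proof
    fix a assume "a \<in> symbolic_exponents"
    moreover have "indep {}" by (simp add: indep_def)
    ultimately have "2 \<le> weight (V - {}) a" unfolding symbolic_exponents_def by blast
    then have "weight V a \<noteq> 0" by simp
    then show "a \<in> {a. Poly_Mapping.keys a \<inter> V \<noteq> {}}" using finite_V by (simp add: weight_eq_0_iff)
  qed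
  then have "?J \<subseteq> ?P" unfolding monom_ideal_def face_prime_def by blast
  then have sub: "ideal_plus (polys V) ?J ?fs \<subseteq> ?P" using fsP by (rule ideal_plus_subset[OF P])
  have proper: "ideal_plus (polys V) ?J ?fs \<noteq> polys V"
  proof
    assume eq: "ideal_plus (polys V) ?J ?fs = polys V"
    have "1 \<in> ?P" using sub one_closed unfolding eq by (rule subsetD)
    then show False by (simp add: face_prime_def monom_ideal_def)
  qed
  have "weakly_regular (polys V) ?J ?fs"
    using monom_regular_symbolic_exponents[OF t, of "TYPE('k)"] unfolding monom_regular_def .
  then have reg: "regular_sequence (quot_module (mpoly_ring V) ?J) ?fs"
    using proper by (rule regular_sequence_quot_module[OF J elem_syms_in_polys])
  have max: "set ?fs \<subseteq> graded_maximal_ideal V"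
  proof -
    interpret R: cring "mpoly_ring V :: (('v \<Rightarrow>\<^sub>0 nat) \<Rightarrow>\<^sub>0 'k) ring" by (rule cring_mpoly_ring)
    have sub: "mvar ` V \<subseteq> carrier (mpoly_ring V :: (('v \<Rightarrow>\<^sub>0 nat) \<Rightarrow>\<^sub>0 'k) ring)"
      unfolding mpoly_ring_simps by (intro image_subsetI mvar_in_polys)
    have "ring_ideal (polys V) (graded_maximal_ideal V :: (('v \<Rightarrow>\<^sub>0 nat) \<Rightarrow>\<^sub>0 'k) set)"
      unfolding ideal_mpoly_ring_iff[symmetric] graded_maximal_ideal_def by (rule R.genideal_ideal[OF sub])
    moreover have "mvar v \<in> (graded_maximal_ideal V :: (('v \<Rightarrow>\<^sub>0 nat) \<Rightarrow>\<^sub>0 'k) set)" if "v \<in> V \<inter> V" for v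
      using R.genideal_self[OF sub] that unfolding graded_maximal_ideal_def by blast
    ultimately have "?P \<subseteq> graded_maximal_ideal V" by (rule face_prime_subset_ideal)
    then show ?thesis using fsP by blast
  qed
  have "t = length ?fs" by (simp add: elem_syms_def)
  then have "enat t \<in> {enat (length fs) | fs. set fs \<subseteq> graded_maximal_ideal V \<and>
      regular_sequence (quot_module (mpoly_ring V) ?J) fs}"
    using reg max by blast
  then show ?thesis
    unfolding second_symbolic_power_edge_monom_ideal depth_def by (rule Sup_upper)
qed


section \<open>Vertex connectivity and the degrees of the complementary graph\<close>

lemma card_complement_neighbours_le:
  fixes G :: "'v pair_pre_digraph"
  assumes G: "pair_graph G"
  shows "card {w. (v, w) \<in> parcs (complement_graph G)} \<le> card (pverts G) - vertex_connectivity G - 1"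
proof (cases "{w. (v, w) \<in> parcs (complement_graph G)} = {}")
  case False
  let ?N = "{w. (v, w) \<in> parcs (complement_graph G)}"
  interpret pair_graph G by (rule G)
  have v: "v \<in> pverts G" "v \<notin> ?N" and sub: "?N \<subseteq> pverts G"
    using False unfolding complement_graph_def by auto
  \<comment> \<open>The vertex \<open>u\<close> separates this case from the excluded one: if
    \<open>v\<close> has no neighbour in the complementary graph, deleting its neighbours in
    \<open>G\<close> leaves the single vertex \<open>v\<close>, which is connected.\<close>
  obtain u where u: "u \<in> ?N" using False by blast
  let ?U = "insert v ?N"
  let ?W = "pverts G - ?U"
  let ?H = "with_proj G \<restriction> ?U"
  have no_arc: "(v, w) \<notin> arcs_ends (mk_symmetric ?H)" for w
    using arcs_symmetric no_loops'
    by (auto simp: mk_symmetric_def arcs_ends_def arc_to_ends_def complement_graph_def)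
  have "\<not> reachable (with_proj (mk_symmetric ?H)) v u"
  proof
    assume "reachable (with_proj (mk_symmetric ?H)) v u"
    then have "(v, u) \<in> (arcs_ends (mk_symmetric ?H))\<^sup>*"
      unfolding reachable_def by (rule rtrancl_on_rtranclI)
    then show False
    proof (cases rule: converse_rtranclE)
      case base
      then show False using u v(2) by simp
    next
      case (step w)
      then show False using no_arc by simp
    qed
  qed
  then have "\<not> Digraph_Component.connected ?H"
    unfolding connected_def strongly_connected_def using u by (auto simp: mk_symmetric_def)
  moreover have "pverts G - ?W = ?U" using v sub by blast
  ultimately have "vertex_connectivity G \<le> card ?W"
    unfolding vertex_connectivity_def by (intro Least_le exI[of _ ?W]) auto
  moreover have fin: "finite ?N" by (rule finite_subset[OF sub]) simp
  have "card ?W = card (pverts G) - card ?U" using v sub fin by (intro card_Diff_subset) auto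
  moreover have "card ?U = card ?N + 1" using v(2) fin by simp
  moreover have "card ?U \<le> card (pverts G)" using v sub by (intro card_mono) auto
  ultimately show ?thesis by linarith
qed simp

theorem theorem3p1:
  fixes G :: "'v pair_pre_digraph"
    and S :: "(('v \<Rightarrow>\<^sub>0 nat) \<Rightarrow>\<^sub>0 'k::field) ring"
    and n k :: nat
  assumes "pair_graph G"
    and "n = card (pverts G)"
    and "\<not> complete_digraph n (with_proj G)"
    and "k = vertex_connectivity G"
    and "S = mpoly_ring (pverts G)"
  shows "depth (graded_maximal_ideal (pverts G))
           (quot_module S (second_symbolic_power S (edge_ideal (complement_graph G))))
         \<ge> enat (nat \<lceil>real k / (2 * (real n - real k - 1))\<rceil>)"
proof -
  interpret pair_graph G by fact
  have kn: "k + 2 \<le> n" using vertex_connectivity_bound assms by simp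
  define d where "d = n - k - 1"
  define N where "N v = {w. (v, w) \<in> parcs (complement_graph G)}" for v
  interpret H: pair_graph "complement_graph G" by (rule pair_graph_complement) fact
  interpret B: bounded_degree_graph "pverts G" N d
  proof
    show "card (N v) \<le> d" for v
      unfolding N_def d_def assms(2,4) by (rule card_complement_neighbours_le) fact
    show "u \<in> N v \<Longrightarrow> v \<in> N u" for u v
      unfolding N_def using H.arcs_symmetric by blast
    show "0 < d" using kn by (simp add: d_def)
  qed (auto simp: N_def complement_graph_def)
  define t where "t = nat \<lceil>real k / (2 * (real n - real k - 1))\<rceil>"
  have d: "real n - real k - 1 = real d" "0 < d" using kn by (simp_all add: d_def)
  \<comment> \<open>A ceiling exceeds its argument by less than 1. Multiplied by
    \<open>2 * d\<close> this reads \<open>2 * d * t < k + 2 * d\<close>, and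
    \<open>k \<le> n\<close> gives the bound required of \<open>t\<close>.\<close>
  have "real t < real k / (2 * real d) + 1"
    unfolding t_def d(1) using ceiling_correct[of "real k / (2 * real d)"] by simp
  then have "2 * real d * real t < real k + 2 * real d"
    using d(2) by (simp add: field_simps)
  then have "real (2 * d * t) < real (k + 2 * d)" by simp
  then have "2 * d * t < card (pverts G) + 2 * d" using kn unfolding of_nat_less_iff assms(2) by simp
  moreover have "edge_ideal (complement_graph G) = B.edge_monom_ideal TYPE('k)"
    unfolding edge_ideal_def B.edge_monom_ideal_def N_def by (simp add: complement_graph_def)
  ultimately show ?thesis
    using B.depth_second_symbolic_power[where 'k = 'k] unfolding assms(5) t_def[symmetric] by simp
qed


end
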